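(* For every $\beta\in(0,1-\tfrac{\sqrt6}{3}]$ and $c_0>0$ there is a constant $C>0$ depending only on $\beta$ and $c_0$ such that the following holds. Let $\epsilon>0$, and let $\{z_t\},\{y_t\},\{x_t\}$ be generated by the AC-FGM algorithm (see context) applied to $\min_{x\in X}\{\Psi(x)=f(x)+h(x)\}$, where $f$ is convex with Hölder continuous (sub)gradients with exponent $\nu\in[0,1]$ and constant $L_\nu>0$, with $x_0=y_0=z_0\in X$, $\eta_1>0$ such that $x_1\neq x_0$, $\beta_1=0$, $\beta_t=\beta$ for $t\ge2$, $\tau_1=0$, $\tau_t=\tfrac t2$ for $t\ge2$, and $$\eta_2=\min\{(1-\beta)\eta_1,\tfrac1{4\tilde L_1(\epsilon)}\},\quad \eta_3=\min\{\eta_2,\tfrac1{4\tilde L_2(\epsilon)}\},\quad \eta_t=\min\{\tfrac t{t-1}\eta_{t-1},\tfrac{t-1}{8\tilde L_{t-1}(\epsilon)}\}\ (t\ge4),$$ where the $\tilde L_t(\epsilon)$ are defined in the context. Suppose $$\eta_1^{-1}\le c_0\Big(\tfrac1\epsilon\Big)^{\frac{1-\nu}{1+\nu}}L_\nu^{\frac2{1+\nu}}\qquad\text{and}\qquad\eta_1\le\frac{2}{5\tilde L_1(\epsilon)}.$$ Then for every $x^*\in X^*$ and every $k\ge1$, $$\Psi(\bar x_k)-\Psi(x^* )\le C\Big(\frac{L_\nu^2}{\epsilon^{1-\nu}k^{1+3\nu}}\Big)^{\frac1{1+\nu}}\|z_0-x^*\|^2+\frac\epsilon2,$$ where $$\bar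 x_k:=\frac{\sum_{t=1}^{k-1}\big[(\tau_t+1)\eta_{t+1}-\tau_{t+1}\eta_{t+2}\big]x_t+(\tau_k+1)\eta_{k+1}x_k}{\sum_{t=2}^{k+1}\eta_t}.$$ The same conclusion holds, with $C$ depending only on $\beta$, $c_0$ and $\alpha$, if for some $\alpha\in(0,1]$ the parameters $\tau_t$ ($t\ge 2$) and $\eta_t$ ($t\ge2$) are instead chosen as $\tau_2=1$, $\eta_2=\min\{(1-\beta)\eta_1,\tfrac1{4\tilde L_1(\epsilon)}\}$, and for $t\ge3$ $$\eta_t=\min\Big\{\tfrac43\eta_{t-1},\ \tfrac{\tau_{t-2}+1}{\tau_{t-1}}\,\eta_{t-1},\ \tfrac{\tau_{t-1}}{4\tilde L_{t-1}(\epsilon)}\Big\},\qquad\tau_t=\tau_{t-1}+\tfrac\alpha2+\tfrac{2(1-\alpha)\eta_t\tilde L_{t-1}(\epsilon)}{\tau_{t-1}}.$$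
   Context: Problem: $X\subseteq\mathbb{R}^n$ is a nonempty closed convex set, $h:X\to\mathbb{R}$ is a closed convex function, $f:\mathbb{R}^n\to\mathbb{R}$ is convex, $\Psi:=f+h$, and the set $X^*$ of minimizers of $\Psi$ over $X$ is nonempty. $\langle\cdot,\cdot\rangle$ is the Euclidean inner product and $\|\cdot\|$ the Euclidean norm. $g(x)\in\partial f(x)$ denotes the (sub)gradient returned by the first-order oracle at $x$. Hölder condition: for some $\nu\in[0,1]$ and $L_\nu>0$ (unknown to the algorithm), $\|g(x)-g(y)\|\le L_\nu\|x-y\|^\nu$ for all $x,y\in\mathbb{R}^n$. AC-FGM algorithm: starting from $z_0=y_0=x_0\in X$, for $t=1,2,\dots$ $$z_t=\arg\min_{z\in X}\big\{\eta_t[\langle g(x_{t-1}),z\rangle+h(z)]+\tfrac12\|y_{t-1}-z\|^2\big\},$$ $$y_t=(1-\beta_t)y_{t-1}+\beta_tz_t,\qquad x_t=\frac{z_t+\tau_tx_{t-1}}{1+\tau_t}.$$ The parameters may depend on previously generated iterates. Local constants for accuracy $\epsilon>0$: $$\tilde L_1(\epsilon):=\frac{\sqrt{\|x_1-x_0\|^2\|g(x_1)-g(x_0)\|^2+(\epsilon/4)^2}-\epsilon/4}{\|x_1-x_0\|^2},$$ $$\tilde L_t(\epsilon):=\frac{\|g(x_t)-g(x_{t-1})\|^2}{2[f(x_{t-1})-f(x_t)-\langle g(x_t),x_{t-1}-x_t\rangle]+\epsilon/\tau_t}\quad(t\ge2).$$ Conventions: $\tfrac00=0$ and $\tfrac a0=+\infty$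 for $a>0$. *)

theory Defs
  imports "HOL-Analysis.Analysis"
begin

text \<open>
  The constants in the convergence bounds must not depend on the dimension, so the dimension has to
  be quantified inside the formula and cannot be a type.  Every coordinate space of dimension \<open>n\<close> is
  therefore realised as the subspace \<open>Rn n\<close> of the space of finitely supported real sequences
  with its standard inner product.  On \<open>Rn n\<close> inner product, norm and topology are the Euclidean
  ones (lemmas \<open>inner_Rn\<close>, \<open>norm_Rn\<close>), and \<open>Rn n\<close> is closed, so that a subset of \<open>Rn n\<close> is closed
  in the type iff it is closed in \<open>Rn n\<close>.
\<close>

typedef fseq = "{x :: nat \<Rightarrow> real. finite {i. x i \<noteq> 0}}"
  morphisms coord Abs_fseq
  by (rule exI[of _ "\<lambda>_. 0"]) simp

setup_lifting type_definition_fseq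

lemma finite_coord [simp]: "finite {i. coord x i \<noteq> 0}"
  using coord[of x] by simp

lemma fseq_eqI: "(\<And>i. coord x i = coord y i) \<Longrightarrow> x = y"
  by (rule coord_inject[THEN iffD1], rule ext)

instantiation fseq :: real_vector
begin

lift_definition zero_fseq :: fseq is "\<lambda>_. 0" by simp

lift_definition plus_fseq :: "fseq \<Rightarrow> fseq \<Rightarrow> fseq" is "\<lambda>x y i. x i + y i"
proof -
  fix x y :: "nat \<Rightarrow> real"
  assume "finite {i. x i \<noteq> 0}" "finite {i. y i \<noteq> 0}"
  then show "finite {i. x i + y i \<noteq> 0}"
    by (rule finite_subset[rotated, OF finite_UnI]) auto
qed

lift_definition uminus_fseq :: "fseq \<Rightarrow> fseq" is "\<lambda>x i. - x i" by simp

lift_definition minus_fseq :: "fseq \<Rightarrow> fseq \<Rightarrow> fseq" is "\<lambda>x y i. x i - y i"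
proof -
  fix x y :: "nat \<Rightarrow> real"
  assume "finite {i. x i \<noteq> 0}" "finite {i. y i \<noteq> 0}"
  then show "finite {i. x i - y i \<noteq> 0}"
    by (rule finite_subset[rotated, OF finite_UnI]) auto
qed

lift_definition scaleR_fseq :: "real \<Rightarrow> fseq \<Rightarrow> fseq" is "\<lambda>r x i. r * x i"
  by (erule rev_finite_subset) auto

instance
proof
  fix x y z :: fseq and r s :: real
  show "x + y + z = x + (y + z)" by transfer (simp add: add.assoc)
  show "x + y = y + x" by transfer (simp add: add.commute)
  show "0 + x = x" by transfer simp
  show "- x + x = 0" by transfer simp
  show "x - y = x + - y" by transfer simp
  show "r *\<^sub>R (x + y) = r *\<^sub>R x + r *\<^sub>R y" by transfer (simp add: distrib_left)
  show "(r + s) *\<^sub>R x = r *\<^sub>R x + s *\<^sub>R x" by transfer (simp add: distrib_right)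
  show "r *\<^sub>R s *\<^sub>R x = (r * s) *\<^sub>R x" by transfer (simp add: mult.assoc)
  show "1 *\<^sub>R x = x" by transfer simp
qed

end

instantiation fseq :: real_inner
begin

definition inner_fseq :: "fseq \<Rightarrow> fseq \<Rightarrow> real"
  where "inner_fseq x y = (\<Sum>i | coord x i \<noteq> 0. coord x i * coord y i)"

definition norm_fseq :: "fseq \<Rightarrow> real"
  where "norm_fseq x = sqrt (inner x x)"

definition sgn_fseq :: "fseq \<Rightarrow> fseq"
  where "sgn_fseq x = x /\<^sub>R norm x"

definition dist_fseq :: "fseq \<Rightarrow> fseq \<Rightarrow> real"
  where "dist_fseq x y = norm (x - y)"

definition uniformity_fseq :: "(fseq \<times> fseq) filter"
  where "uniformity_fseq = (INF e\<in>{0 <..}. principal {(x, y). dist x y < e})"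

definition open_fseq :: "fseq set \<Rightarrow> bool"
  where "open_fseq U = (\<forall>x\<in>U. \<forall>\<^sub>F (x', y) in uniformity. x' = x \<longrightarrow> y \<in> U)"

lemma inner_fseq_superset:
  assumes "finite A" "{i. coord x i \<noteq> 0} \<subseteq> A \<or> {i. coord y i \<noteq> 0} \<subseteq> A"
  shows "inner x y = (\<Sum>i\<in>A. coord x i * coord y i)"
proof -
  let ?B = "{i. coord x i \<noteq> 0} \<union> A"
  have "inner x y = (\<Sum>i\<in>?B. coord x i * coord y i)"
    unfolding inner_fseq_def using assms(1) by (intro sum.mono_neutral_left) auto
  also have "\<dots> = (\<Sum>i\<in>A. coord x i * coord y i)"
    using assms by (intro sum.mono_neutral_right) auto
  finally show ?thesis .
qed

instance
proof
  fix x y :: fseq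
  show "sgn x = x /\<^sub>R norm x" by (fact sgn_fseq_def)
  show "dist x y = norm (x - y)" by (fact dist_fseq_def)
  show "norm x = sqrt (inner x x)" by (fact norm_fseq_def)
  show "uniformity = (INF e\<in>{0 <..}. principal {(x :: fseq, y). dist x y < e})"
    by (fact uniformity_fseq_def)
  fix U :: "fseq set"
  show "open U = (\<forall>x\<in>U. \<forall>\<^sub>F (x', y) in uniformity. x' = x \<longrightarrow> y \<in> U)"
    by (fact open_fseq_def)
next
  fix x y z :: fseq and r :: real
  let ?A = "{i. coord x i \<noteq> 0} \<union> {i. coord y i \<noteq> 0}"
  have "inner x y = (\<Sum>i\<in>?A. coord x i * coord y i)" by (rule inner_fseq_superset) auto
  also have "\<dots> = (\<Sum>i\<in>?A. coord y i * coord x i)" by (simp add: mult.commute)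
  also have "\<dots> = inner y x" by (rule inner_fseq_superset[symmetric]) auto
  finally show "inner x y = inner y x" .
  let ?Z = "{i. coord z i \<noteq> 0}"
  have z: "inner u z = (\<Sum>i\<in>?Z. coord u i * coord z i)" for u
    by (rule inner_fseq_superset) auto
  show "inner (x + y) z = inner x z + inner y z"
    by (simp add: z plus_fseq.rep_eq distrib_right sum.distrib)
  show "inner (r *\<^sub>R x) y = r * inner x y"
  proof -
    have "inner u y = (\<Sum>i\<in>{i. coord y i \<noteq> 0}. coord u i * coord y i)" for u
      by (rule inner_fseq_superset) auto
    then show ?thesis by (simp add: scaleR_fseq.rep_eq sum_distrib_left mult.assoc)
  qed
  show "0 \<le> inner x x" unfolding inner_fseq_def by (intro sum_nonneg) auto
  show "inner x x = 0 \<longleftrightarrow> x = 0"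
  proof
    assume "inner x x = 0"
    then have "\<forall>i\<in>{i. coord x i \<noteq> 0}. coord x i * coord x i = 0"
      unfolding inner_fseq_def by (subst (asm) sum_nonneg_eq_0_iff) auto
    then show "x = 0" by (intro fseq_eqI) (auto simp: zero_fseq.rep_eq)
  qed (simp add: inner_fseq_def zero_fseq.rep_eq)
qed

end

definition Rn :: "nat \<Rightarrow> fseq set"
  where "Rn n = {x. \<forall>i\<ge>n. coord x i = 0}"

lemma inner_Rn:
  assumes "x \<in> Rn n"
  shows "inner x y = (\<Sum>i<n. coord x i * coord y i)"
proof (rule inner_fseq_superset)
  show "{i. coord x i \<noteq> 0} \<subseteq> {..<n} \<or> {i. coord y i \<noteq> 0} \<subseteq> {..<n}"
    using assms by (auto simp: Rn_def not_le[symmetric])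
qed simp

lemma norm_Rn: "x \<in> Rn n \<Longrightarrow> norm x = sqrt (\<Sum>i<n. (coord x i)\<^sup>2)"
  by (simp add: norm_eq_sqrt_inner inner_Rn power2_eq_square)

lemma subspace_Rn: "subspace (Rn n)"
  by (auto simp: subspace_def Rn_def zero_fseq.rep_eq plus_fseq.rep_eq scaleR_fseq.rep_eq)

lemma Rn_coords: "\<exists>!x. x \<in> Rn n \<and> (\<forall>i<n. coord x i = v i)"
proof -
  define w where "w = Abs_fseq (\<lambda>i. if i < n then v i else 0)"
  have "finite {i. (if i < n then v i else 0) \<noteq> 0}"
    by (rule finite_subset[of _ "{..<n}"]) auto
  then have w: "coord w = (\<lambda>i. if i < n then v i else 0)"
    unfolding w_def by (intro Abs_fseq_inverse) simp
  show ?thesis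
  proof (rule ex1I[of _ w])
    show "w \<in> Rn n \<and> (\<forall>i<n. coord w i = v i)"
      by (simp add: Rn_def w)
    show "x = w" if x: "x \<in> Rn n \<and> (\<forall>i<n. coord x i = v i)" for x
    proof (rule fseq_eqI)
      show "coord x i = coord w i" for i
        using x by (cases "i < n") (auto simp: Rn_def w)
    qed
  qed
qed

lemma closed_Rn: "closed (Rn n)"
proof -
  define e where "e i = Abs_fseq (\<lambda>j. if j = i then 1 else 0)" for i :: nat
  have e: "coord (e i) = (\<lambda>j. if j = i then 1 else 0)" for i
    unfolding e_def by (rule Abs_fseq_inverse) simp
  have "inner (e i) x = coord x i" for i x
    by (subst inner_fseq_superset[of "{i}"]) (auto simp: e)
  then have "Rn n = (\<Inter>i\<in>{n..}. {x. inner (e i) x = 0})"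
    by (auto simp: Rn_def)
  then show ?thesis by (auto intro!: closed_INT closed_hyperplane)
qed

definition minimizers :: "'a set \<Rightarrow> ('a \<Rightarrow> real) \<Rightarrow> 'a set"
  where "minimizers X F = {x. is_arg_min F (\<lambda>u. u \<in> X) x}"

definition subdifferential :: "'a::real_inner set \<Rightarrow> ('a \<Rightarrow> real) \<Rightarrow> 'a \<Rightarrow> 'a set"
  where "subdifferential S f x = {v \<in> S. \<forall>u\<in>S. f u \<ge> f x + inner v (u - x)}"

text \<open>
  Functions on \<open>Rn n\<close> or on \<open>X\<close> are total functions whose values elsewhere are irrelevant.
  A convex \<open>h\<close> on \<open>X\<close> is closed when its epigraph is closed.
\<close>

definition composite_problem :: "nat \<Rightarrow> fseq set \<Rightarrow> (fseq \<Rightarrow> real) \<Rightarrow> (fseq \<Rightarrow> real) \<Rightarrow> bool"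
  where "composite_problem n X f h \<longleftrightarrow>
    X \<subseteq> Rn n \<and> X \<noteq> {} \<and> closed X \<and> convex X \<and>
    convex_on (Rn n) f \<and>
    convex_on X h \<and> closed (epigraph X h) \<and>
    minimizers X (\<lambda>u. f u + h u) \<noteq> {}"

text \<open>
  The value \<open>0 powr 0 = 0\<close> is harmless below: for equal points the left-hand side vanishes.
\<close>

definition holder_oracle ::
    "nat \<Rightarrow> (fseq \<Rightarrow> real) \<Rightarrow> (fseq \<Rightarrow> fseq) \<Rightarrow> real \<Rightarrow> real \<Rightarrow> bool"
  where "holder_oracle n f g \<nu> L \<longleftrightarrow>
    (\<forall>u\<in>Rn n. g u \<in> subdifferential (Rn n) f u) \<and>
    (\<forall>u\<in>Rn n. \<forall>v\<in>Rn n. norm (g u - g v) \<le> L * norm (u - v) powr \<nu>)"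

definition ac_fgm ::
    "fseq set \<Rightarrow> (fseq \<Rightarrow> real) \<Rightarrow> (fseq \<Rightarrow> fseq) \<Rightarrow>
     (nat \<Rightarrow> real) \<Rightarrow> (nat \<Rightarrow> real) \<Rightarrow> (nat \<Rightarrow> real) \<Rightarrow>
     (nat \<Rightarrow> fseq) \<Rightarrow> (nat \<Rightarrow> fseq) \<Rightarrow> (nat \<Rightarrow> fseq) \<Rightarrow> bool"
  where "ac_fgm X h g \<eta> b \<tau> z y x \<longleftrightarrow>
    x 0 \<in> X \<and> y 0 = x 0 \<and> z 0 = x 0 \<and>
    (\<forall>t\<ge>1.
      is_arg_min (\<lambda>u. \<eta> t * (inner (g (x (t - 1))) u + h u) + 1/2 * (norm (y (t - 1) - u))\<^sup>2)
        (\<lambda>u. u \<in> X) (z t) \<and>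
      y t = (1 - b t) *\<^sub>R y (t - 1) + b t *\<^sub>R z t \<and>
      x t = (z t + \<tau> t *\<^sub>R x (t - 1)) /\<^sub>R (1 + \<tau> t))"

text \<open>
  Quotients are taken in \<^typ>\<open>ereal\<close>, where \<open>0 / 0 = 0\<close> and \<open>a / 0 = \<infinity>\<close> for \<open>a > 0\<close>; this is the
  convention needed when a local constant vanishes.  The value at \<open>t = 0\<close> is never used.
\<close>

definition local_const ::
    "(fseq \<Rightarrow> real) \<Rightarrow> (fseq \<Rightarrow> fseq) \<Rightarrow> (nat \<Rightarrow> real) \<Rightarrow> (nat \<Rightarrow> fseq) \<Rightarrow> real \<Rightarrow> nat \<Rightarrow> ereal"
  where "local_const f g \<tau> x \<epsilon> t =
    (if t = 1 then
       ereal (sqrt ((norm (x 1 - x 0))\<^sup>2 * (norm (g (x 1) - g (x 0)))\<^sup>2 + (\<epsilon> / 4)\<^sup>2) - \<epsilon> / 4)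
         / ereal ((norm (x 1 - x 0))\<^sup>2)
     else
       ereal ((norm (g (x t) - g (x (t - 1))))\<^sup>2)
         / (ereal (2 * (f (x (t - 1)) - f (x t) - inner (g (x t)) (x (t - 1) - x t)))
            + ereal \<epsilon> / ereal (\<tau> t)))"

definition linear_rule :: "real \<Rightarrow> (nat \<Rightarrow> ereal) \<Rightarrow> (nat \<Rightarrow> real) \<Rightarrow> (nat \<Rightarrow> real) \<Rightarrow> bool"
  where "linear_rule \<beta> Lt \<eta> \<tau> \<longleftrightarrow>
    \<tau> 1 = 0 \<and> (\<forall>t\<ge>2. \<tau> t = real t / 2) \<and>
    ereal (\<eta> 2) = min (ereal ((1 - \<beta>) * \<eta> 1)) (1 / (4 * Lt 1)) \<and>
    ereal (\<eta> 3) = min (ereal (\<eta> 2)) (1 / (4 * Lt 2)) \<and>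
    (\<forall>t\<ge>4. ereal (\<eta> t) =
      min (ereal (real t / (real t - 1) * \<eta> (t - 1))) (ereal (real t - 1) / (8 * Lt (t - 1))))"

definition adaptive_rule ::
    "real \<Rightarrow> real \<Rightarrow> (nat \<Rightarrow> ereal) \<Rightarrow> (nat \<Rightarrow> real) \<Rightarrow> (nat \<Rightarrow> real) \<Rightarrow> bool"
  where "adaptive_rule \<alpha> \<beta> Lt \<eta> \<tau> \<longleftrightarrow>
    \<tau> 1 = 0 \<and> \<tau> 2 = 1 \<and>
    ereal (\<eta> 2) = min (ereal ((1 - \<beta>) * \<eta> 1)) (1 / (4 * Lt 1)) \<and>
    (\<forall>t\<ge>3.
      ereal (\<eta> t) =
        min (ereal (4 / 3 * \<eta> (t - 1)))
          (min (ereal ((\<tau> (t - 2) + 1) / \<tau> (t - 1) * \<eta> (t - 1)))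
             (ereal (\<tau> (t - 1)) / (4 * Lt (t - 1)))) \<and>
      ereal (\<tau> t) =
        ereal (\<tau> (t - 1) + \<alpha> / 2)
          + ereal (2 * (1 - \<alpha>) * \<eta> t) * Lt (t - 1) / ereal (\<tau> (t - 1)))"

definition ergodic_mean ::
    "(nat \<Rightarrow> real) \<Rightarrow> (nat \<Rightarrow> real) \<Rightarrow> (nat \<Rightarrow> 'a::real_vector) \<Rightarrow> nat \<Rightarrow> 'a"
  where "ergodic_mean \<eta> \<tau> x k =
    ((\<Sum>t = 1..k - 1. ((\<tau> t + 1) * \<eta> (t + 1) - \<tau> (t + 1) * \<eta> (t + 2)) *\<^sub>R x t)
       + ((\<tau> k + 1) * \<eta> (k + 1)) *\<^sub>R x k)
    /\<^sub>R (\<Sum>t = 2..k + 1. \<eta> t)"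

definition ac_fgm_run ::
    "real \<Rightarrow> real \<Rightarrow> nat \<Rightarrow> fseq set \<Rightarrow> (fseq \<Rightarrow> real) \<Rightarrow> (fseq \<Rightarrow> real) \<Rightarrow> (fseq \<Rightarrow> fseq) \<Rightarrow>
     real \<Rightarrow> real \<Rightarrow> real \<Rightarrow> (nat \<Rightarrow> real) \<Rightarrow> (nat \<Rightarrow> real) \<Rightarrow> (nat \<Rightarrow> real) \<Rightarrow>
     (nat \<Rightarrow> fseq) \<Rightarrow> (nat \<Rightarrow> fseq) \<Rightarrow> (nat \<Rightarrow> fseq) \<Rightarrow> bool"
  where "ac_fgm_run \<beta> c\<^sub>0 n X f h g \<nu> L \<epsilon> \<eta> b \<tau> z y x \<longleftrightarrow>
    composite_problem n X f h \<and>
    0 \<le> \<nu> \<and> \<nu> \<le> 1 \<and> 0 < L \<and> holder_oracle n f g \<nu> L \<and>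
    0 < \<epsilon> \<and>
    ac_fgm X h g \<eta> b \<tau> z y x \<and>
    0 < \<eta> 1 \<and> x 1 \<noteq> x 0 \<and>
    b 1 = 0 \<and> (\<forall>t\<ge>2. b t = \<beta>) \<and>
    inverse (\<eta> 1) \<le> c\<^sub>0 * (1 / \<epsilon>) powr ((1 - \<nu>) / (1 + \<nu>)) * L powr (2 / (1 + \<nu>)) \<and>
    ereal (\<eta> 1) \<le> 2 / (5 * local_const f g \<tau> x \<epsilon> 1)"

end

(*
  Write p_t = z_t - y_{t-1}.  Adding the prox inequality at step t + 1, rewritten in terms of y_{t+1},
  to the one at step t tested against z_{t+1}, shows that ||y_t - u||^2 / (2 beta) + |p_t|^2 / 4
  decreases by a weighted optimality gap, up to an error eta_{t+1} eps / 2: the local constant is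
  chosen so that the Bregman term of f absorbs the gradient difference, the slack eps / tau_t in its
  denominator being what is paid.  After telescoping, Jensen's inequality bounds the gap at the
  ergodic mean by ||z_0 - u||^2 / (2 beta sum eta_t) + eps / 2.

  With kappa = (1 - nu) / (1 + nu) and A = L^(2/(1+nu)) eps^(-kappa), the Hoelder condition gives
  Lt_t <= 4 A tau_t^kappa, and then the step-size rule forces eta_t >= const * tau_t^(1-kappa) / A by
  induction, because away from the initial phase it lets eta grow at least as fast as tau, which is
  linear in t.  The linear rule is the adaptive rule with alpha = 1.
*)
theory Submission
  imports Defs
begin

text \<open>The growth cap 4/3 and the range of \<beta> are matched. Steps t and t + 1 use different
  step sizes, so the cross term between p_t and z_(t+1) - z_t carries the ratio \<eta>_(t+1) /
  \<eta>_t. It is absorbed when that ratio is at most 2 (1 - \<beta>)^2; with the cap 4/3 this asks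
  for (1 - \<beta>)^2 >= 2/3, that is \<beta> <= 1 - sqrt 6 / 3. The first iteration falls outside
  this pattern: \<tau>_1 = 0 leaves no Bregman term, so Lt_1 is instead the root of a quadratic
  whose two terms are paid by |p_1|^2 and by the \<epsilon> budget, while the upper bound on
  \<eta>_1 keeps \<eta>_2 / \<eta>_1 away from 0. The rate appears because step sizes of order
  t^(1-\<kappa>) / A sum to order k^(2-\<kappa>) / A, and 2 - \<kappa> = (1 + 3\<nu>) / (1 + \<nu>).
  As C must not depend on \<nu>, numerical factors with \<nu> in the exponent are replaced by
  uniform bounds.\<close>

section \<open>Proximal optimality and consequences of Hoelder continuity\<close>

lemma prox_variational_inequality:
  fixes z :: "'a::real_inner"
  assumes "convex_on X \<phi>"
    and z: "is_arg_min (\<lambda>u. \<phi> u + 1/2 * (norm (y - u))\<^sup>2) (\<lambda>u. u \<in> X) z"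
    and "u \<in> X"
  shows "\<phi> z - \<phi> u \<le> inner (y - z) (z - u)"
proof (rule field_le_epsilon)
  fix e :: real assume "0 < e"
  have "z \<in> X" and min: "\<And>v. v \<in> X \<Longrightarrow> \<phi> z + 1/2 * (norm (y - z))\<^sup>2 \<le> \<phi> v + 1/2 * (norm (y - v))\<^sup>2"
    using z by (auto simp: is_arg_min_linorder)
  \<comment> \<open>Instead of a limit along the segment from z to u, one explicit s is used: after
    division by s the quadratic error is s * |u - z|^2 / 2, and this s makes it at most e. The
    summand 1 covers u = z.\<close>
  define s where "s = min 1 (e / (1 + (norm (u - z))\<^sup>2))"
  have s: "0 < s" "s \<le> 1" using \<open>0 < e\<close> by (auto simp: s_def add_pos_nonneg)
  have "s * (1 + (norm (u - z))\<^sup>2) \<le> e / (1 + (norm (u - z))\<^sup>2) * (1 + (norm (u - z))\<^sup>2)"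
    unfolding s_def by (intro mult_right_mono) auto
  also have "\<dots> = e" by (simp add: add_nonneg_eq_0_iff)
  finally have se: "s * (norm (u - z))\<^sup>2 \<le> e" using s by (simp add: algebra_simps)
  let ?v = "(1 - s) *\<^sub>R z + s *\<^sub>R u"
  have "convex X" using assms(1) by (simp add: convex_on_def)
  then have "?v \<in> X" using \<open>z \<in> X\<close> \<open>u \<in> X\<close> s by (simp add: convex_alt)
  then have m: "\<phi> z + 1/2 * (norm (y - z))\<^sup>2 \<le> \<phi> ?v + 1/2 * (norm (y - ?v))\<^sup>2" by (rule min)
  have c: "\<phi> ?v \<le> (1 - s) * \<phi> z + s * \<phi> u"
    using convex_onD[OF assms(1), of s z u] s \<open>z \<in> X\<close> \<open>u \<in> X\<close> by simp
  have "y - ?v = (y - z) - s *\<^sub>R (u - z)" by (simp add: algebra_simps)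
  then have n: "(norm (y - ?v))\<^sup>2 = (norm (y - z))\<^sup>2 - 2 * s * inner (y - z) (u - z) + s\<^sup>2 * (norm (u - z))\<^sup>2"
    by (simp only: power2_norm_eq_inner inner_diff_left inner_diff_right
        inner_scaleR_left inner_scaleR_right) (simp add: inner_commute power2_eq_square algebra_simps)
  have "s * (\<phi> z - \<phi> u + inner (y - z) (u - z)) \<le> s * (s * (norm (u - z))\<^sup>2 / 2)"
    using m c n by (simp add: algebra_simps power2_eq_square)
  then have "\<phi> z - \<phi> u + inner (y - z) (u - z) \<le> s * (norm (u - z))\<^sup>2 / 2"
    using s by simp
  moreover have "inner (y - z) (u - z) = - inner (y - z) (z - u)"
    by (simp add: inner_diff_right)
  moreover have "0 \<le> s * (norm (u - z))\<^sup>2" using s by simp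
  ultimately show "\<phi> z - \<phi> u \<le> inner (y - z) (z - u) + e" using se by linarith
qed

text \<open>M is the value for which 2 * L factors as (\<delta> M)^((1-\<nu>)/2) * M^\<nu>. The left
  side is then a product of powers of \<delta> M and G^2 with exponents (1-\<nu>)/2 and (1+\<nu>)/2,
  which sum to 1, so Young's inequality applies. It is the Hoelder error of a gradient step of
  length G / M, scaled by 2 * M.\<close>

lemma powr_smoothness_constant:
  fixes G L \<delta> \<nu> :: real
  assumes "0 < G" "0 < L" "0 < \<delta>" "0 \<le> \<nu>" "\<nu> \<le> 1"
    and M: "M = (2 * L) powr (2 / (1 + \<nu>)) * (1 / \<delta>) powr ((1 - \<nu>) / (1 + \<nu>))"
  shows "2 * L * G * (G / M) powr \<nu> \<le> G\<^sup>2 + \<delta> * M"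
proof -
  have "0 < M" using assms by simp
  have n: "(1 + \<nu>) \<noteq> 0" using assms by simp
  have L: "2 * L = (\<delta> * M) powr ((1 - \<nu>) / 2) * M powr \<nu>"
  proof -
    have "M powr ((1 + \<nu>) / 2) = 2 * L * (1 / \<delta>) powr ((1 - \<nu>) / 2)"
    proof -
      have e: "2 / (1 + \<nu>) * ((1 + \<nu>) / 2) = 1" "(1 - \<nu>) / (1 + \<nu>) * ((1 + \<nu>) / 2) = (1 - \<nu>) / 2"
        using n by (simp_all add: divide_simps)
      then show ?thesis
        unfolding M powr_mult[of "(2 * L) powr _"] powr_powr e using assms by simp
    qed
    moreover have "M powr ((1 + \<nu>) / 2) = M powr ((1 - \<nu>) / 2) * M powr \<nu>"
      by (simp flip: powr_add add: field_simps)
    ultimately show ?thesis using assms(1-5) \<open>0 < M\<close>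
      by (simp add: powr_mult powr_divide field_simps)
  qed
  have G: "(G\<^sup>2) powr ((1 + \<nu>) / 2) = G * G powr \<nu>"
  proof -
    have "(G\<^sup>2) powr ((1 + \<nu>) / 2) = (G powr 2) powr ((1 + \<nu>) / 2)" using assms by simp
    also have "\<dots> = G powr (1 + \<nu>)" by (simp only: powr_powr) (simp add: add_divide_distrib)
    finally show ?thesis using assms by (simp add: powr_add)
  qed
  have "2 * L * G * (G / M) powr \<nu> = (\<delta> * M) powr ((1 - \<nu>) / 2) * (G\<^sup>2) powr ((1 + \<nu>) / 2)"
    unfolding L G using assms(1-5) \<open>0 < M\<close> by (simp add: powr_divide)
  also have "\<dots> \<le> (1 - \<nu>) / 2 * (\<delta> * M) + (1 + \<nu>) / 2 * G\<^sup>2"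
    using assms \<open>0 < M\<close> by (intro Youngs_inequality_0) (auto simp: field_simps)
  also have "\<dots> \<le> 1 * (\<delta> * M) + 1 * G\<^sup>2"
    using assms \<open>0 < M\<close> by (intro add_mono mult_right_mono) auto
  finally show ?thesis by simp
qed

text \<open>
  The comparison point is one gradient step of length \<open>1 / M\<close> from \<open>v\<close> for the tilted function
  \<open>f - \<langle>g u, \<cdot>\<rangle>\<close>, whose minimum is attained at \<open>u\<close>.
\<close>

lemma holder_smoothness_gap:
  fixes f :: "'a::real_inner \<Rightarrow> real"
  assumes "subspace S"
    and gS: "\<And>u. u \<in> S \<Longrightarrow> g u \<in> S"
    and sub: "\<And>u v. u \<in> S \<Longrightarrow> v \<in> S \<Longrightarrow> f u + inner (g u) (v - u) \<le> f v"
    and holder: "\<And>u v. u \<in> S \<Longrightarrow> v \<in> S \<Longrightarrow> norm (g u - g v) \<le> L * norm (u - v) powr \<nu>"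
    and "0 < L" "0 < \<delta>" "0 \<le> \<nu>" "\<nu> \<le> 1" "u \<in> S" "v \<in> S"
  shows "(norm (g u - g v))\<^sup>2 \<le> 4 * (L powr (2 / (1 + \<nu>)) * (1 / \<delta>) powr ((1 - \<nu>) / (1 + \<nu>)))
           * (2 * (f v - f u - inner (g u) (v - u)) + \<delta>)"
proof (cases "g u = g v")
  case True
  then show ?thesis using sub[of u v] assms by simp
next
  case False
  define M where "M = (2 * L) powr (2 / (1 + \<nu>)) * (1 / \<delta>) powr ((1 - \<nu>) / (1 + \<nu>))"
  define G where "G = norm (g v - g u)"
  have pos: "0 < M" "0 < G" using False assms by (auto simp: M_def G_def)
  let ?D = "f v - f u - inner (g u) (v - u)"
  have D0: "0 \<le> ?D" using sub[OF \<open>u \<in> S\<close> \<open>v \<in> S\<close>] by simp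
  define w where "w = v - (1 / M) *\<^sub>R (g v - g u)"
  have w: "w \<in> S" unfolding w_def using assms by (intro subspace_diff subspace_scale gS) auto
  have wv: "v - w = (1 / M) *\<^sub>R (g v - g u)" by (simp add: w_def)
  have "f w + inner (g w) (v - w) \<le> f v" "f u + inner (g u) (w - u) \<le> f w"
    using sub w assms by auto
  moreover have "inner (g u) (w - u) = inner (g u) (v - u) - inner (g u) (v - w)"
    by (simp add: inner_diff_right)
  moreover have "inner (g w) (v - w) - inner (g u) (v - w)
      = inner (g v - g u) (v - w) + inner (g w - g v) (v - w)"
    by (simp add: inner_diff_left)
  moreover have "inner (g v - g u) (v - w) = G\<^sup>2 / M"
    unfolding wv G_def by (simp add: power2_norm_eq_inner)
  moreover have "- inner (g w - g v) (v - w) \<le> L * (G / M) powr \<nu> * (G / M)"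
  proof -
    have nw: "norm (v - w) = G / M" using pos by (simp add: wv G_def)
    have "- inner (g w - g v) (v - w) \<le> norm (g w - g v) * norm (v - w)"
      using Cauchy_Schwarz_ineq2[of "g w - g v" "v - w"] by linarith
    also have "\<dots> \<le> L * norm (v - w) powr \<nu> * norm (v - w)"
      using holder[OF w \<open>v \<in> S\<close>] by (intro mult_right_mono) (auto simp: norm_minus_commute)
    finally show ?thesis by (simp add: nw)
  qed
  ultimately have "G\<^sup>2 / M - L * (G / M) powr \<nu> * (G / M) \<le> ?D" by linarith
  then have "M * (G\<^sup>2 / M - L * (G / M) powr \<nu> * (G / M)) \<le> M * ?D"
    using pos by (intro mult_left_mono) auto
  then have "2 * G\<^sup>2 - 2 * L * G * (G / M) powr \<nu> \<le> M * (2 * ?D)"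
    using pos by (simp add: right_diff_distrib mult_ac)
  moreover have "2 * L * G * (G / M) powr \<nu> \<le> G\<^sup>2 + \<delta> * M"
    using pos assms by (intro powr_smoothness_constant) (auto simp: M_def)
  ultimately have "G\<^sup>2 \<le> M * (2 * ?D + \<delta>)" by (simp add: algebra_simps)
  \<comment> \<open>M contains 2^(2/(1+\<nu>)); bounding this by 2^2 keeps the constant free of
    \<nu>.\<close>
  also have "M \<le> 4 * (L powr (2 / (1 + \<nu>)) * (1 / \<delta>) powr ((1 - \<nu>) / (1 + \<nu>)))"
  proof -
    have "(2::real) powr (2 / (1 + \<nu>)) \<le> 2 powr 2"
      using assms by (intro powr_mono) (auto simp: field_simps)
    then have "2 powr (2 / (1 + \<nu>)) * (L powr (2 / (1 + \<nu>)) * (1 / \<delta>) powr ((1 - \<nu>) / (1 + \<nu>)))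
        \<le> 4 * (L powr (2 / (1 + \<nu>)) * (1 / \<delta>) powr ((1 - \<nu>) / (1 + \<nu>)))"
      by (intro mult_right_mono) auto
    then show ?thesis using assms by (simp add: M_def powr_mult mult.assoc)
  qed
  then have "M * (2 * ?D + \<delta>) \<le> 4 * (L powr (2 / (1 + \<nu>)) * (1 / \<delta>) powr ((1 - \<nu>) / (1 + \<nu>))) * (2 * ?D + \<delta>)"
    using D0 assms by (intro mult_right_mono) auto
  finally show ?thesis by (simp add: G_def norm_minus_commute)
qed

text \<open>Young's inequality with weights \<nu> and 1 - \<nu>, applied to the two summands on the
  left of the last assumption, produces D^(2\<nu>), the same power of the distance as on the right.
  Hence D cancels and a bound independent of the iterates remains.\<close>

lemma first_curvature_bound:
  fixes l D L \<epsilon> \<nu> :: real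
  assumes "0 \<le> l" "0 < D" "0 < L" "0 < \<epsilon>" "0 \<le> \<nu>" "\<nu> \<le> 1"
    and "l\<^sup>2 * D\<^sup>2 + l * \<epsilon> / 2 \<le> (L * D powr \<nu>)\<^sup>2"
  shows "l \<le> 2 * (L powr (2 / (1 + \<nu>)) * (1 / \<epsilon>) powr ((1 - \<nu>) / (1 + \<nu>)))"
proof (cases "l = 0")
  case False
  then have l: "0 < l" using assms by simp
  have sq: "(a\<^sup>2) powr p = a powr (2 * p)" if "0 < a" for a p :: real
    using that powr_powr[of a 2 p] by simp
  have e2: "(L * D powr \<nu>)\<^sup>2 = L powr 2 * D powr (2 * \<nu>)"
    using assms by (simp add: power_mult_distrib powr_power mult.commute)
  have "l powr (1 + \<nu>) * D powr (2 * \<nu>) * (\<epsilon> / 2) powr (1 - \<nu>)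
      = (l\<^sup>2 * D\<^sup>2) powr \<nu> * (l * \<epsilon> / 2) powr (1 - \<nu>)"
  proof -
    have "l powr (1 + \<nu>) = l powr (2 * \<nu>) * l powr (1 - \<nu>)" by (simp add: algebra_simps flip: powr_add)
    then show ?thesis using l assms by (simp add: powr_mult powr_divide sq)
  qed
  also have "\<dots> \<le> \<nu> * (l\<^sup>2 * D\<^sup>2) + (1 - \<nu>) * (l * \<epsilon> / 2)"
    using l assms by (intro Youngs_inequality_0) auto
  also have "\<dots> \<le> 1 * (l\<^sup>2 * D\<^sup>2) + 1 * (l * \<epsilon> / 2)"
    using l assms by (intro add_mono mult_right_mono) auto
  also have "\<dots> \<le> L powr 2 * D powr (2 * \<nu>)" using assms e2 by simp
  finally have "l powr (1 + \<nu>) * (\<epsilon> / 2) powr (1 - \<nu>) * D powr (2 * \<nu>) \<le> L powr 2 * D powr (2 * \<nu>)"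
    by (simp add: mult_ac)
  then have "l powr (1 + \<nu>) * (\<epsilon> / 2) powr (1 - \<nu>) \<le> L powr 2" using assms by simp
  then have "(l powr (1 + \<nu>) * (\<epsilon> / 2) powr (1 - \<nu>)) powr (1 / (1 + \<nu>)) \<le> (L powr 2) powr (1 / (1 + \<nu>))"
    using assms by (intro powr_mono2) auto
  then have "l * (\<epsilon> / 2) powr ((1 - \<nu>) / (1 + \<nu>)) \<le> L powr (2 / (1 + \<nu>))"
    using l assms by (simp add: powr_mult powr_powr sq)
  then have "l \<le> 2 powr ((1 - \<nu>) / (1 + \<nu>)) * (L powr (2 / (1 + \<nu>)) * (1 / \<epsilon>) powr ((1 - \<nu>) / (1 + \<nu>)))"
    using l assms by (simp add: powr_divide field_simps)
  also have "\<dots> \<le> 2 * (L powr (2 / (1 + \<nu>)) * (1 / \<epsilon>) powr ((1 - \<nu>) / (1 + \<nu>)))"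
  proof -
    have "(2::real) powr ((1 - \<nu>) / (1 + \<nu>)) \<le> 2 powr 1"
      using assms by (intro powr_mono) (auto simp: field_simps)
    then show ?thesis by (intro mult_right_mono) auto
  qed
  finally show ?thesis .
qed simp

section \<open>Descent per iteration and the gap at the ergodic mean\<close>

text \<open>Collects what the descent argument takes from an algorithm run, with real-valued local
  constants \<open>l\<close>. \<open>l_first\<close> is the quadratic equation whose nonnegative
  root is the first local constant, \<open>l_later\<close> the definition of the later ones with the
  denominator cleared. \<open>weight\<close> says that the coefficients of the ergodic mean are
  nonnegative.\<close>

locale composite_fgm =
  fixes X :: "'a::real_inner set" and f h :: "'a \<Rightarrow> real" and g :: "'a \<Rightarrow> 'a"
    and \<beta> \<epsilon> :: real and \<eta> \<tau> l :: "nat \<Rightarrow> real" and z y x :: "nat \<Rightarrow> 'a"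
  assumes f_convex: "convex_on X f" and h_convex: "convex_on X h"
    and subgrad: "\<And>u v. u \<in> X \<Longrightarrow> v \<in> X \<Longrightarrow> f u + inner (g u) (v - u) \<le> f v"
    and \<beta>: "0 < \<beta>" "\<beta> \<le> 1 - sqrt 6 / 3"
    and \<epsilon>: "0 < \<epsilon>"
    and \<eta>_pos: "\<And>t. 1 \<le> t \<Longrightarrow> 0 < \<eta> t"
    and \<tau>1: "\<tau> 1 = 0"
    and \<tau>_pos: "\<And>t. 2 \<le> t \<Longrightarrow> 0 < \<tau> t"
    and l_nonneg: "\<And>t. 1 \<le> t \<Longrightarrow> 0 \<le> l t"
    and l_first: "(norm (g (x 1) - g (x 0)))\<^sup>2 = (l 1)\<^sup>2 * (norm (x 1 - x 0))\<^sup>2 + l 1 * \<epsilon> / 2"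
    and l_later: "\<And>t. 2 \<le> t \<Longrightarrow> (norm (g (x t) - g (x (t - 1))))\<^sup>2
        = l t * (2 * (f (x (t - 1)) - f (x t) - inner (g (x t)) (x (t - 1) - x t)) + \<epsilon> / \<tau> t)"
    and x_mem: "\<And>t. x t \<in> X"
    and z_mem: "\<And>t. z t \<in> X"
    and start: "y 0 = x 0" "z 0 = x 0"
    and y1: "y 1 = x 0"
    and prox: "\<And>t u. 1 \<le> t \<Longrightarrow> u \<in> X \<Longrightarrow>
        \<eta> t * (inner (g (x (t - 1))) (z t - u) + h (z t) - h u) \<le> inner (y (t - 1) - z t) (z t - u)"
    and y_step: "\<And>t. 2 \<le> t \<Longrightarrow> y t = (1 - \<beta>) *\<^sub>R y (t - 1) + \<beta> *\<^sub>R z t"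
    and x_step: "\<And>t. 1 \<le> t \<Longrightarrow> z t = x t + \<tau> t *\<^sub>R (x t - x (t - 1))"
    and first_ratio: "5 / 8 * \<eta> 1 \<le> \<eta> 2" "\<eta> 2 \<le> (1 - \<beta>) * \<eta> 1"
    and first_step: "4 * l 1 * \<eta> 2 \<le> 1"
    and later_ratio: "\<And>t. 2 \<le> t \<Longrightarrow> \<eta> (t + 1) \<le> 4 / 3 * \<eta> t"
    and later_step: "\<And>t. 2 \<le> t \<Longrightarrow> 4 * l t * \<eta> (t + 1) \<le> \<tau> t"
    and weight: "\<And>t. 1 \<le> t \<Longrightarrow> \<tau> (t + 1) * \<eta> (t + 2) \<le> (\<tau> t + 1) * \<eta> (t + 1)"
begin

definition gap :: "'a \<Rightarrow> nat \<Rightarrow> real"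
  where "gap u t = f (x t) + h (x t) - (f u + h u)"

definition move :: "nat \<Rightarrow> 'a"
  where "move t = z t - y (t - 1)"

text \<open>The value 2/3 is half of the growth cap 4/3, as needed from the second iteration on; 1/5
  is a rational bound that suffices for the first.\<close>

lemma \<beta>_bounds: "2 / 3 \<le> (1 - \<beta>)\<^sup>2" "\<beta> \<le> 1 / 5"
proof -
  have "sqrt 6 / 3 \<le> 1 - \<beta>" using \<beta> by simp
  then have "(sqrt 6 / 3)\<^sup>2 \<le> (1 - \<beta>)\<^sup>2" by (intro power_mono) auto
  then show "2 / 3 \<le> (1 - \<beta>)\<^sup>2" by (simp add: power_divide)
  have "12 / 5 \<le> sqrt 6" by (rule real_le_rsqrt) (simp add: power2_eq_square)
  then show "\<beta> \<le> 1 / 5" using \<beta> by simp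
qed

lemma young_inner: "inner a b \<le> c / 2 * (norm a)\<^sup>2 + (norm b)\<^sup>2 / (2 * c)" if "0 < c" for a b :: 'a
proof -
  have "0 \<le> (norm (c *\<^sub>R a - b))\<^sup>2 / (2 * c)" using that by simp
  also have "(norm (c *\<^sub>R a - b))\<^sup>2 = c\<^sup>2 * (norm a)\<^sup>2 - 2 * c * inner a b + (norm b)\<^sup>2"
    by (simp only: power2_norm_eq_inner inner_add_left inner_add_right inner_diff_left inner_diff_right
        inner_scaleR_left inner_scaleR_right) (simp add: inner_commute power2_eq_square algebra_simps)
  finally show ?thesis using that by (simp add: field_simps power2_eq_square)
qed

text \<open>
  Trading \<open>z (t + 1)\<close> for \<open>y (t + 1)\<close> in the prox inequality gains the factor \<open>2 - \<beta>\<close> on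
  \<open>move (t + 1)\<close>.
\<close>

lemma averaged_prox:
  assumes "1 \<le> t" "u \<in> X"
  shows "\<eta> (t + 1) * (inner (g (x t)) (z (t + 1) - u) + h (z (t + 1)) - h u)
      + (2 - \<beta>) / 2 * (norm (move (t + 1)))\<^sup>2 + (norm (y (t + 1) - u))\<^sup>2 / (2 * \<beta>)
      \<le> (norm (y t - u))\<^sup>2 / (2 * \<beta>)"
proof -
  define p where "p = move (t + 1)"
  define q where "q = y t - u"
  have z: "z (t + 1) - u = q + p" by (simp add: p_def q_def move_def)
  have yz: "y t - z (t + 1) = - p" by (simp add: p_def move_def)
  have "y (t + 1) - u = q + \<beta> *\<^sub>R p"
    using y_step[of "t + 1"] assms by (simp add: p_def q_def move_def algebra_simps)
  then have "(norm (y (t + 1) - u))\<^sup>2 = (norm q)\<^sup>2 + 2 * \<beta> * inner p q + \<beta>\<^sup>2 * (norm p)\<^sup>2"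
    by (simp only: power2_norm_eq_inner inner_add_left inner_add_right inner_diff_left inner_diff_right
        inner_scaleR_left inner_scaleR_right) (simp add: inner_commute power2_eq_square algebra_simps)
  then have "(norm (y (t + 1) - u))\<^sup>2 / (2 * \<beta>) = (norm q)\<^sup>2 / (2 * \<beta>) + inner p q + \<beta> / 2 * (norm p)\<^sup>2"
    using \<beta> by (simp add: field_simps power2_eq_square)
  moreover have "\<eta> (t + 1) * (inner (g (x t)) (z (t + 1) - u) + h (z (t + 1)) - h u) \<le> - inner p q - (norm p)\<^sup>2"
    using prox[of "t + 1" u] assms unfolding yz z add_diff_cancel_right'
    by (simp add: inner_add_right power2_norm_eq_inner)
  ultimately show ?thesis unfolding p_def[symmetric] q_def[symmetric]
    by (simp add: field_simps)
qed

text \<open>The factor r brings the older inequality to the weight \<open>\<eta> (t + 1)\<close>.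
  Added to the newer one, it cancels \<open>h (z (t + 1))\<close>, and of the linear terms at z (t +
  1) only the gradient difference survives.\<close>

lemma previous_prox:
  assumes "1 \<le> t" "0 \<le> r" "\<eta> (t + 1) = r * \<eta> t"
  shows "\<eta> (t + 1) * (inner (g (x (t - 1))) (z t - z (t + 1)) + h (z t) - h (z (t + 1)))
    \<le> r * inner (move t) (z (t + 1) - z t)"
proof -
  have "\<eta> t * (inner (g (x (t - 1))) (z t - z (t + 1)) + h (z t) - h (z (t + 1)))
      \<le> inner (move t) (z (t + 1) - z t)"
    using prox[of t "z (t + 1)"] assms z_mem
    by (simp add: move_def inner_diff_left inner_diff_right algebra_simps)
  from mult_left_mono[OF this \<open>0 \<le> r\<close>] show ?thesis
    using assms by (simp add: mult.assoc)
qed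

text \<open>Writing z t as x t plus \<tau> t times the last displacement splits the linear term into
  one part at u, bounded by the subgradient inequality, and one at x (t - 1). The latter is kept
  exactly, as a Bregman term, because it later pays for the gradient difference. For h, Jensen is
  used, x t being a convex combination of z t and x (t - 1).\<close>

lemma linearization_gap:
  assumes "1 \<le> t" "u \<in> X" "0 \<le> \<tau> t"
  shows "(1 + \<tau> t) * gap u t - \<tau> t * gap u (t - 1)
      + \<tau> t * (f (x (t - 1)) - f (x t) - inner (g (x t)) (x (t - 1) - x t))
    \<le> inner (g (x t)) (z t - u) + h (z t) - h u"
proof -
  have "f (x t) + inner (g (x t)) (u - x t) \<le> f u" using subgrad x_mem assms by blast
  moreover have "inner (g (x t)) (z t - u)
      = - inner (g (x t)) (u - x t) - \<tau> t * inner (g (x t)) (x (t - 1) - x t)"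
    by (subst x_step[OF \<open>1 \<le> t\<close>]) (simp add: inner_add_right inner_diff_right algebra_simps)
  moreover have "(1 + \<tau> t) * h (x t) \<le> h (z t) + \<tau> t * h (x (t - 1))"
  proof -
    have *: "0 < 1 + \<tau> t" using assms by simp
    have "(1 + \<tau> t) *\<^sub>R x t = z t + \<tau> t *\<^sub>R x (t - 1)"
      by (subst x_step[OF \<open>1 \<le> t\<close>]) (simp add: algebra_simps)
    then have "(1 / (1 + \<tau> t)) *\<^sub>R ((1 + \<tau> t) *\<^sub>R x t) = (1 / (1 + \<tau> t)) *\<^sub>R (z t + \<tau> t *\<^sub>R x (t - 1))"
      by simp
    moreover have e: "1 - \<tau> t / (1 + \<tau> t) = 1 / (1 + \<tau> t)" using * by (simp add: field_simps)
    ultimately have "x t = (1 - \<tau> t / (1 + \<tau> t)) *\<^sub>R z t + (\<tau> t / (1 + \<tau> t)) *\<^sub>R x (t - 1)"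
      using * by (simp add: scaleR_add_right del: scaleR_left_distrib)
    then have "h (x t) \<le> (1 - \<tau> t / (1 + \<tau> t)) * h (z t) + \<tau> t / (1 + \<tau> t) * h (x (t - 1))"
      using convex_onD[OF h_convex, of "\<tau> t / (1 + \<tau> t)" "z t" "x (t - 1)"] x_mem z_mem assms * by simp
    then have "(1 + \<tau> t) * h (x t)
        \<le> (1 + \<tau> t) * ((1 - \<tau> t / (1 + \<tau> t)) * h (z t) + \<tau> t / (1 + \<tau> t) * h (x (t - 1)))"
      using * by (intro mult_left_mono) auto
    also have "\<dots> = h (z t) + \<tau> t * h (x (t - 1))"
      using * unfolding e by (simp add: distrib_left)
    finally show ?thesis .
  qed
  ultimately show ?thesis unfolding gap_def by (simp add: algebra_simps)
qed

lemma combined_prox: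
  assumes "1 \<le> t" "u \<in> X" "0 \<le> r" "\<eta> (t + 1) = r * \<eta> t" "0 \<le> \<tau> t"
  shows "\<eta> (t + 1) * ((1 + \<tau> t) * gap u t - \<tau> t * gap u (t - 1))
      + \<eta> (t + 1) * \<tau> t * (f (x (t - 1)) - f (x t) - inner (g (x t)) (x (t - 1) - x t))
      + \<eta> (t + 1) * inner (g (x t) - g (x (t - 1))) (z (t + 1) - z t)
      + (2 - \<beta>) / 2 * (norm (move (t + 1)))\<^sup>2 - r * inner (move t) (z (t + 1) - z t)
      + (norm (y (t + 1) - u))\<^sup>2 / (2 * \<beta>)
    \<le> (norm (y t - u))\<^sup>2 / (2 * \<beta>)"
proof -
  have "\<eta> (t + 1) * ((1 + \<tau> t) * gap u t - \<tau> t * gap u (t - 1)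
      + \<tau> t * (f (x (t - 1)) - f (x t) - inner (g (x t)) (x (t - 1) - x t)))
    \<le> \<eta> (t + 1) * (inner (g (x t)) (z t - u) + h (z t) - h u)"
    using linearization_gap assms \<eta>_pos[of "t + 1"] by (intro mult_left_mono) auto
  moreover have "\<eta> (t + 1) * (inner (g (x t)) (z t - u) + h (z t) - h u)
        + \<eta> (t + 1) * inner (g (x t) - g (x (t - 1))) (z (t + 1) - z t)
      = \<eta> (t + 1) * (inner (g (x t)) (z (t + 1) - u) + h (z (t + 1)) - h u)
        + \<eta> (t + 1) * (inner (g (x (t - 1))) (z t - z (t + 1)) + h (z t) - h (z (t + 1)))"
    by (simp add: inner_diff_left inner_diff_right algebra_simps)
  ultimately show ?thesis
    using averaged_prox[of t u] previous_prox[of t r] assms by (simp add: algebra_simps)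
qed

lemma later_descent:
  assumes "2 \<le> t" "u \<in> X"
  shows "\<eta> (t + 1) * ((1 + \<tau> t) * gap u t - \<tau> t * gap u (t - 1))
      + (norm (y (t + 1) - u))\<^sup>2 / (2 * \<beta>) + (norm (move (t + 1)))\<^sup>2 / 4
    \<le> (norm (y t - u))\<^sup>2 / (2 * \<beta>) + (norm (move t))\<^sup>2 / 4 + \<eta> (t + 1) * (\<epsilon> / 2)"
proof -
  define r where "r = \<eta> (t + 1) / \<eta> t"
  define P where "P = norm (move t)"
  define Q where "Q = norm (move (t + 1))"
  define s where "s = inner (move t) (move (t + 1))"
  let ?D = "f (x (t - 1)) - f (x t) - inner (g (x t)) (x (t - 1) - x t)"
  let ?dg = "g (x t) - g (x (t - 1))" and ?dz = "z (t + 1) - z t"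
  have pos: "0 < \<eta> t" "0 < \<eta> (t + 1)" "0 < \<tau> t" using \<eta>_pos \<tau>_pos assms by auto
  have r: "0 \<le> r" "\<eta> (t + 1) = r * \<eta> t" "r \<le> 4 / 3"
    using pos later_ratio[OF \<open>2 \<le> t\<close>] by (auto simp: r_def field_simps)
  have b: "4 / 5 \<le> 1 - \<beta>" "1 - \<beta> < 1" using \<beta>_bounds \<beta> by auto
  have r2: "r \<le> 2 * (1 - \<beta>)\<^sup>2" using r \<beta>_bounds by simp
  have dz: "?dz = move (t + 1) - (1 - \<beta>) *\<^sub>R move t"
    using y_step[OF \<open>2 \<le> t\<close>] by (simp add: move_def algebra_simps)
  \<comment> \<open>Young's inequality with weight \<tau> t / l t produces exactly the squared
    gradient difference contained in the Bregman term, at the price of the \<epsilon> slack. The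
    step-size cap reduces the remaining coefficient to 1/8. As l t is a divisor here, l t = 0 is
    separate: then the gradients agree.\<close>
  have grad: "- (\<eta> (t + 1) * (\<epsilon> / 2)) - (norm ?dz)\<^sup>2 / 8 \<le> \<eta> (t + 1) * \<tau> t * ?D + \<eta> (t + 1) * inner ?dg ?dz"
  proof (cases "l t = 0")
    case True
    then have "?dg = 0" using l_later[OF \<open>2 \<le> t\<close>] by simp
    moreover have "0 \<le> ?D" using subgrad[OF x_mem x_mem, of t "t - 1"] by simp
    ultimately show ?thesis using pos \<epsilon>
      by (simp del: right_minus_eq) (smt (verit) mult_nonneg_nonneg zero_le_power2 divide_nonneg_nonneg)
  next
    case False
    then have l: "0 < l t" using l_nonneg[of t] assms by simp
    have D: "\<eta> (t + 1) * \<tau> t * ?D = \<eta> (t + 1) * (\<tau> t * (norm ?dg)\<^sup>2 / (2 * l t)) - \<eta> (t + 1) * (\<epsilon> / 2)"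
      using l pos by (subst l_later[OF \<open>2 \<le> t\<close>]) (simp add: field_simps)
    have "- inner ?dg ?dz \<le> \<tau> t / (l t) / 2 * (norm (- ?dg))\<^sup>2 + (norm ?dz)\<^sup>2 / (2 * (\<tau> t / l t))"
      using young_inner[of "\<tau> t / l t" "- ?dg" ?dz] l pos unfolding inner_minus_left by fastforce
    then have "\<eta> (t + 1) * (- inner ?dg ?dz)
        \<le> \<eta> (t + 1) * (\<tau> t / (l t) / 2 * (norm (- ?dg))\<^sup>2 + (norm ?dz)\<^sup>2 / (2 * (\<tau> t / l t)))"
      using pos by (intro mult_left_mono) auto
    also have "\<dots> = \<eta> (t + 1) * (\<tau> t * (norm ?dg)\<^sup>2 / (2 * l t)) + (4 * l t * \<eta> (t + 1) / \<tau> t) * (norm ?dz)\<^sup>2 / 8"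
      using l pos by (simp add: field_simps norm_minus_commute)
    also have "(4 * l t * \<eta> (t + 1) / \<tau> t) * (norm ?dz)\<^sup>2 / 8 \<le> 1 * (norm ?dz)\<^sup>2 / 8"
      using later_step[OF \<open>2 \<le> t\<close>] pos by (intro divide_right_mono mult_right_mono) auto
    finally show ?thesis unfolding D by simp
  qed
  \<comment> \<open>Parallelogram identity with the sum term dropped. Divided by 8 it costs P^2/4,
    which is the old potential term, and Q^2/4, which leaves Q^2/4 of the available Q^2/2 as the new
    one.\<close>
  have n: "(norm ?dz)\<^sup>2 \<le> 2 * Q\<^sup>2 + 2 * P\<^sup>2"
  proof -
    have "(norm ?dz)\<^sup>2 = 2 * Q\<^sup>2 + 2 * (1 - \<beta>)\<^sup>2 * P\<^sup>2 - (norm (move (t + 1) + (1 - \<beta>) *\<^sub>R move t))\<^sup>2"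
      unfolding dz P_def Q_def
      by (simp only: power2_norm_eq_inner inner_diff_left inner_diff_right inner_add_left inner_add_right
          inner_scaleR_left inner_scaleR_right) (simp add: inner_commute power2_eq_square algebra_simps)
    also have "\<dots> \<le> 2 * Q\<^sup>2 + 2 * 1 * P\<^sup>2 - 0"
      using b by (intro diff_mono add_mono mult_right_mono) (auto simp: power_le_one)
    finally show ?thesis by simp
  qed
  \<comment> \<open>The Young weight 2 (1 - \<beta>) is chosen so that the P^2 terms cancel exactly.
    The factor r <= 2 (1 - \<beta>)^2 then leaves no more than (1 - \<beta>)/2 of Q^2; this is where
    the range of \<beta> enters.\<close>
  have "r * inner (move t) ?dz \<le> (1 - \<beta>) / 2 * Q\<^sup>2"
  proof -
    have i: "inner (move t) ?dz = s - (1 - \<beta>) * P\<^sup>2"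
      unfolding dz s_def P_def by (simp add: inner_diff_right power2_norm_eq_inner)
    have "s \<le> 2 * (1 - \<beta>) / 2 * P\<^sup>2 + Q\<^sup>2 / (2 * (2 * (1 - \<beta>)))"
      unfolding s_def P_def Q_def using b by (intro young_inner) auto
    also have "\<dots> = (1 - \<beta>) * P\<^sup>2 + Q\<^sup>2 / (4 * (1 - \<beta>))" by simp
    finally have "inner (move t) ?dz \<le> Q\<^sup>2 / (4 * (1 - \<beta>))" unfolding i by linarith
    then have "r * inner (move t) ?dz \<le> r * (Q\<^sup>2 / (4 * (1 - \<beta>)))" using r by (intro mult_left_mono)
    also have "\<dots> \<le> 2 * (1 - \<beta>)\<^sup>2 * (Q\<^sup>2 / (4 * (1 - \<beta>)))"
      using r2 b by (intro mult_right_mono) auto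
    also have "\<dots> = (1 - \<beta>) / 2 * Q\<^sup>2"
    proof -
      have eq: "2 * c\<^sup>2 * (w / (4 * c)) = c / 2 * w" if "0 < c" for c w :: real
        using that by (simp add: power2_eq_square)
      show ?thesis by (rule eq) (use b in simp)
    qed
    finally show ?thesis .
  qed
  moreover have "(2 - \<beta>) / 2 * Q\<^sup>2 = (1 - \<beta>) / 2 * Q\<^sup>2 + Q\<^sup>2 / 2" by (simp add: field_simps)
  moreover have "1 \<le> t" "0 \<le> \<tau> t" using assms pos by auto
  note combined_prox[OF this(1) \<open>u \<in> X\<close> r(1,2) this(2)]
  ultimately show ?thesis using grad n unfolding P_def Q_def by linarith
qed

text \<open>Since \<beta>_1 = \<tau>_1 = 0, here y 1 = x 0 and z 1 = x 1, so \<open>move 1\<close>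
  is the displacement occurring in the equation for l 1. Without a Bregman term the gradient
  difference costs P^2/8 in addition; the prox inequality of step 1 supplies r * P^2 to cover it, so
  no term in \<open>move 1\<close> remains on the right.\<close>

lemma first_descent:
  assumes "u \<in> X"
  shows "\<eta> 2 * gap u 1 + (norm (y 2 - u))\<^sup>2 / (2 * \<beta>) + (norm (move 2))\<^sup>2 / 4
    \<le> (norm (z 0 - u))\<^sup>2 / (2 * \<beta>) + \<eta> 2 * (\<epsilon> / 2)"
proof -
  define r where "r = \<eta> 2 / \<eta> 1"
  define P where "P = norm (move 1)"
  define Q where "Q = norm (move 2)"
  define s where "s = inner (move 1) (move 2)"
  let ?dg = "g (x 1) - g (x 0)" and ?dz = "z 2 - z 1"
  have pos: "0 < \<eta> 1" "0 < \<eta> 2" using \<eta>_pos by auto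
  have r: "\<eta> 2 = r * \<eta> 1" "5 / 8 \<le> r" "r \<le> 1 - \<beta>"
    using pos first_ratio by (auto simp: r_def field_simps)
  have z1: "z 1 = x 1" using x_step[of 1] \<tau>1 by simp
  have m: "move 1 = z 1 - y 0" "move 2 = z 2 - y 1" by (simp_all add: move_def)
  have dz: "?dz = move 2 - move 1" and m1: "move 1 = x 1 - x 0"
    unfolding m y1 start z1 by simp_all
  have ndz: "(norm ?dz)\<^sup>2 = Q\<^sup>2 - 2 * s + P\<^sup>2"
    unfolding dz P_def Q_def s_def
    by (simp add: power2_norm_eq_inner inner_diff_left inner_diff_right inner_commute)
  have i: "inner (move 1) ?dz = s - P\<^sup>2"
    unfolding dz s_def P_def by (simp add: inner_diff_right power2_norm_eq_inner)
  have grad: "- (\<eta> 2 * (\<epsilon> / 2)) - P\<^sup>2 / 8 - (norm ?dz)\<^sup>2 / 8 \<le> \<eta> 2 * inner ?dg ?dz"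
  proof (cases "l 1 = 0")
    case True
    then have "?dg = 0" using l_first by simp
    then show ?thesis using pos \<epsilon>
      by (simp del: right_minus_eq) (smt (verit) mult_nonneg_nonneg zero_le_power2 divide_nonneg_nonneg)
  next
    case False
    then have l: "0 < l 1" using l_nonneg[of 1] by simp
    have "- inner ?dg ?dz \<le> 1 / l 1 / 2 * (norm (- ?dg))\<^sup>2 + (norm ?dz)\<^sup>2 / (2 * (1 / l 1))"
      using young_inner[of "1 / l 1" "- ?dg" ?dz] l unfolding inner_minus_left by fastforce
    also have "\<dots> = l 1 * P\<^sup>2 / 2 + \<epsilon> / 4 + l 1 * (norm ?dz)\<^sup>2 / 2"
      using l by (simp only: norm_minus_cancel l_first P_def m1) (simp add: field_simps power2_eq_square)
    finally have "\<eta> 2 * (- inner ?dg ?dz) \<le> \<eta> 2 * (l 1 * P\<^sup>2 / 2 + \<epsilon> / 4 + l 1 * (norm ?dz)\<^sup>2 / 2)"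
      using pos by (intro mult_left_mono) auto
    also have "\<dots> = (4 * l 1 * \<eta> 2) * (P\<^sup>2 + (norm ?dz)\<^sup>2) / 8 + \<eta> 2 * \<epsilon> / 4"
      by (simp add: field_simps)
    also have "(4 * l 1 * \<eta> 2) * (P\<^sup>2 + (norm ?dz)\<^sup>2) / 8 \<le> 1 * (P\<^sup>2 + (norm ?dz)\<^sup>2) / 8"
      using first_step by (intro divide_right_mono mult_right_mono) auto
    finally have "\<eta> 2 * (- inner ?dg ?dz) \<le> (P\<^sup>2 + (norm ?dz)\<^sup>2) / 8 + \<eta> 2 * \<epsilon> / 4" by simp
    moreover have "0 \<le> \<eta> 2 * \<epsilon>" using pos \<epsilon> by simp
    ultimately show ?thesis by (simp add: field_simps)
  qed
  have "Q\<^sup>2 / 4 \<le> (2 - \<beta>) / 2 * Q\<^sup>2 - r * (s - P\<^sup>2) - P\<^sup>2 / 8 - (norm ?dz)\<^sup>2 / 8"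
  proof -
    \<comment> \<open>The net coefficient of s is r from the prox term less 1/4 from expanding
      |dz|^2 / 8; it is nonnegative because r >= 5/8. Young weight 2 makes the P^2 part match the
      available (r - 1/4) * P^2.\<close>
    have "(r - 1 / 4) * s \<le> (r - 1 / 4) * (2 / 2 * P\<^sup>2 + Q\<^sup>2 / (2 * 2))"
      unfolding s_def P_def Q_def using r by (intro mult_left_mono young_inner) auto
    then have "r * s - s / 4 \<le> r * P\<^sup>2 - P\<^sup>2 / 4 + (r - 1 / 4) * (Q\<^sup>2 / 4)"
      by (simp add: field_simps)
    also have "(r - 1 / 4) * (Q\<^sup>2 / 4) \<le> 3 / 4 * (Q\<^sup>2 / 4)"
      using r \<beta> by (intro mult_right_mono) auto
    finally have "r * s - s / 4 \<le> r * P\<^sup>2 - P\<^sup>2 / 4 + 3 / 4 * (Q\<^sup>2 / 4)" by simp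
    moreover have "\<beta> * Q\<^sup>2 \<le> 1 / 5 * Q\<^sup>2"
      using \<beta>_bounds by (intro mult_right_mono) auto
    moreover have "0 \<le> Q\<^sup>2" by simp
    moreover have "(2 - \<beta>) / 2 * Q\<^sup>2 - r * (s - P\<^sup>2) - P\<^sup>2 / 8 - (Q\<^sup>2 - 2 * s + P\<^sup>2) / 8
        = 7 / 8 * Q\<^sup>2 - \<beta> * Q\<^sup>2 / 2 - (r * s - s / 4) + (r * P\<^sup>2 - P\<^sup>2 / 4)"
      by (simp add: field_simps)
    ultimately show ?thesis unfolding ndz by linarith
  qed
  then show ?thesis
    using combined_prox[of 1 u r, unfolded one_add_one diff_self_eq_0 \<tau>1 y1 i] r(1,2) grad assms start
    unfolding P_def Q_def by simp
qed

lemma weighted_gap_bound: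
  assumes "u \<in> X" "1 \<le> k"
  shows "(\<Sum>t = 1..k. \<eta> (t + 1) * ((1 + \<tau> t) * gap u t - \<tau> t * gap u (t - 1)))
      + (norm (y (k + 1) - u))\<^sup>2 / (2 * \<beta>) + (norm (move (k + 1)))\<^sup>2 / 4
    \<le> (norm (z 0 - u))\<^sup>2 / (2 * \<beta>) + (\<Sum>t = 1..k. \<eta> (t + 1)) * (\<epsilon> / 2)"
  using \<open>1 \<le> k\<close>
proof (induction k rule: dec_induct)
  case base
  show ?case using first_descent[OF \<open>u \<in> X\<close>] \<tau>1 by (simp add: numeral_2_eq_2)
next
  case (step k)
  then show ?case using later_descent[of "Suc k" u] \<open>u \<in> X\<close> by (simp add: distrib_right add_divide_distrib)
qed

definition avg_weight :: "nat \<Rightarrow> nat \<Rightarrow> real"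
  where "avg_weight k t = (if t < k then (\<tau> t + 1) * \<eta> (t + 1) - \<tau> (t + 1) * \<eta> (t + 2)
     else (\<tau> k + 1) * \<eta> (k + 1))"

text \<open>Summation by parts; \<tau> 1 = 0 removes a 0. With a constantly 1 it also shows that the
  weights add up to the sum of the step sizes, the normaliser of the ergodic mean.\<close>

lemma sum_avg_weight:
  assumes "1 \<le> k"
  shows "(\<Sum>t = 1..k. avg_weight k t * a t)
    = (\<Sum>t = 1..k. \<eta> (t + 1) * ((1 + \<tau> t) * a t - \<tau> t * a (t - 1)))"
proof -
  have split: "(\<Sum>t = 1..k. avg_weight k t * a t)
      = (\<Sum>t = 1..<k. ((\<tau> t + 1) * \<eta> (t + 1) - \<tau> (t + 1) * \<eta> (t + 2)) * a t) + (\<tau> k + 1) * \<eta> (k + 1) * a k"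
    if "1 \<le> k" for k
  proof -
    have "{1..k} = insert k {1..<k}" using that by auto
    then show ?thesis by (simp add: avg_weight_def)
  qed
  from assms show ?thesis
  proof (induction k rule: dec_induct)
    case base
    then show ?case using \<tau>1 by (simp add: avg_weight_def)
  next
    case (step k)
    then show ?case unfolding split[OF \<open>1 \<le> k\<close>] split[of "Suc k", OF le_SucI[OF \<open>1 \<le> k\<close>]]
      by (simp add: algebra_simps)
  qed
qed

lemma ergodic_mean_eq:
  assumes "1 \<le> k"
  shows "ergodic_mean \<eta> \<tau> x k = (\<Sum>t = 1..k. (avg_weight k t / (\<Sum>t = 2..k + 1. \<eta> t)) *\<^sub>R x t)"
proof -
  have "{1..k} = insert k {1..k - 1}" "k \<notin> {1..k - 1}" using assms by auto
  then have "(\<Sum>t = 1..k. avg_weight k t *\<^sub>R x t)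
      = (\<Sum>t = 1..k - 1. avg_weight k t *\<^sub>R x t) + avg_weight k k *\<^sub>R x k"
    by (simp add: add.commute)
  also have "(\<Sum>t = 1..k - 1. avg_weight k t *\<^sub>R x t)
      = (\<Sum>t = 1..k - 1. ((\<tau> t + 1) * \<eta> (t + 1) - \<tau> (t + 1) * \<eta> (t + 2)) *\<^sub>R x t)"
    by (intro sum.cong) (auto simp: avg_weight_def)
  finally have "ergodic_mean \<eta> \<tau> x k = (\<Sum>t = 1..k. avg_weight k t *\<^sub>R x t) /\<^sub>R (\<Sum>t = 2..k + 1. \<eta> t)"
    unfolding ergodic_mean_def by (simp add: avg_weight_def[of k k])
  then show ?thesis by (simp add: scaleR_sum_right divide_inverse mult.commute)
qed

theorem ergodic_gap:
  assumes "u \<in> X" "1 \<le> k"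
  shows "f (ergodic_mean \<eta> \<tau> x k) + h (ergodic_mean \<eta> \<tau> x k) - (f u + h u)
    \<le> (norm (z 0 - u))\<^sup>2 / (2 * \<beta>) / (\<Sum>t = 2..k + 1. \<eta> t) + \<epsilon> / 2"
proof -
  define S where "S = (\<Sum>t = 2..k + 1. \<eta> t)"
  have S: "S = (\<Sum>t = 1..k. \<eta> (t + 1))"
    unfolding S_def using sum.shift_bounds_cl_nat_ivl[of \<eta> 1 1 k] by (simp add: numeral_2_eq_2)
  have "0 < S" unfolding S_def using assms \<eta>_pos by (intro sum_pos) auto
  have w0: "0 \<le> avg_weight k t" if "t \<in> {1..k}" for t
    using weight[of t] that \<eta>_pos[of "k + 1"] \<tau>_pos[of k] \<tau>1 assms
    by (cases "k = 1") (auto simp: avg_weight_def)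
  have w1: "(\<Sum>t = 1..k. avg_weight k t) = S"
    using sum_avg_weight[OF \<open>1 \<le> k\<close>, of "\<lambda>_. 1"] by (simp add: S)
  have "convex_on X (\<lambda>v. f v + h v)" using f_convex h_convex by (rule convex_on_add)
  then have "f (ergodic_mean \<eta> \<tau> x k) + h (ergodic_mean \<eta> \<tau> x k)
      \<le> (\<Sum>t = 1..k. avg_weight k t / S * (f (x t) + h (x t)))"
    unfolding ergodic_mean_eq[OF \<open>1 \<le> k\<close>] S_def[symmetric]
    using w0 w1 \<open>0 < S\<close> \<open>1 \<le> k\<close> x_mem
    by (intro convex_on_sum[where C = X and f = "\<lambda>v. f v + h v"]) (auto simp flip: sum_divide_distrib)
  also have "\<dots> = (\<Sum>t = 1..k. avg_weight k t * gap u t) / S + (\<Sum>t = 1..k. avg_weight k t) / S * (f u + h u)"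
    by (simp add: gap_def sum_divide_distrib sum_distrib_right flip: sum.distrib)
       (simp add: algebra_simps add_divide_distrib diff_divide_distrib)
  finally have "f (ergodic_mean \<eta> \<tau> x k) + h (ergodic_mean \<eta> \<tau> x k) - (f u + h u)
      \<le> (\<Sum>t = 1..k. avg_weight k t * gap u t) / S"
    using \<open>0 < S\<close> w1 by simp
  also have "(\<Sum>t = 1..k. avg_weight k t * gap u t) \<le> (norm (z 0 - u))\<^sup>2 / (2 * \<beta>) + S * (\<epsilon> / 2)"
  proof -
    have "0 \<le> (norm (y (k + 1) - u))\<^sup>2 / (2 * \<beta>)" using \<beta> by simp
    then show ?thesis
      using weighted_gap_bound[OF assms] zero_le_power2[of "norm (move (k + 1))"]
      unfolding sum_avg_weight[OF \<open>1 \<le> k\<close>] S by linarith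
  qed
  then have "(\<Sum>t = 1..k. avg_weight k t * gap u t) / S \<le> ((norm (z 0 - u))\<^sup>2 / (2 * \<beta>) + S * (\<epsilon> / 2)) / S"
    using \<open>0 < S\<close> by (intro divide_right_mono) auto
  also have "\<dots> = (norm (z 0 - u))\<^sup>2 / (2 * \<beta>) / S + \<epsilon> / 2"
    using \<open>0 < S\<close> by (simp add: field_simps)
  finally show ?thesis unfolding S_def .
qed

end

section \<open>Lower bounds for the step sizes\<close>

text \<open>Only real sequences occur here. The minima are recorded as disjunctions, since a lower
  bound on a step size has to come from whichever cap is attained; products in place of quotients
  include the case of a vanishing l.\<close>

locale adaptive_steps =
  fixes \<alpha> \<beta> :: real and l \<eta> \<tau> :: "nat \<Rightarrow> real"
  assumes \<alpha>: "0 < \<alpha>" "\<alpha> \<le> 1" and \<beta>: "0 < \<beta>" "\<beta> < 1"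
    and \<tau>12: "\<tau> 1 = 0" "\<tau> 2 = 1"
    and \<eta>_pos: "\<And>t. 1 \<le> t \<Longrightarrow> 0 < \<eta> t"
    and l_nonneg: "\<And>t. 1 \<le> t \<Longrightarrow> 0 \<le> l t"
    and \<eta>2: "4 * l 1 * \<eta> 2 \<le> 1" "\<eta> 2 = (1 - \<beta>) * \<eta> 1 \<or> 4 * l 1 * \<eta> 2 = 1"
    and \<eta>_step: "\<And>t. 3 \<le> t \<Longrightarrow> 4 * l (t - 1) * \<eta> t \<le> \<tau> (t - 1)"
      "\<And>t. 3 \<le> t \<Longrightarrow> \<eta> t = 4 / 3 * \<eta> (t - 1) \<or> \<eta> t = (\<tau> (t - 2) + 1) / \<tau> (t - 1) * \<eta> (t - 1)
        \<or> 4 * l (t - 1) * \<eta> t = \<tau> (t - 1)"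
    and \<tau>_step: "\<And>t. 3 \<le> t \<Longrightarrow> \<tau> t = \<tau> (t - 1) + \<alpha> / 2 + 2 * (1 - \<alpha>) * \<eta> t * l (t - 1) / \<tau> (t - 1)"
begin

text \<open>The adaptive part of the increment is (1 - \<alpha>)/2 times 4 l \<eta> / \<tau>, and
  the curvature cap on \<eta> bounds that quotient by 1.\<close>

lemma \<tau>_growth:
  assumes "3 \<le> t" "1 \<le> \<tau> (t - 1)"
  shows "\<tau> (t - 1) + \<alpha> / 2 \<le> \<tau> t" "\<tau> t \<le> \<tau> (t - 1) + 1 / 2"
proof -
  have p: "0 \<le> \<eta> t" "0 \<le> l (t - 1)" "0 < \<tau> (t - 1)"
    using \<eta>_pos[of t] l_nonneg[of "t - 1"] assms by auto
  have "0 \<le> 2 * (1 - \<alpha>) * \<eta> t * l (t - 1) / \<tau> (t - 1)" using p \<alpha> by simp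
  then show "\<tau> (t - 1) + \<alpha> / 2 \<le> \<tau> t" using \<tau>_step[OF \<open>3 \<le> t\<close>] by simp
  have "2 * (1 - \<alpha>) * \<eta> t * l (t - 1) / \<tau> (t - 1) = (1 - \<alpha>) / 2 * (4 * l (t - 1) * \<eta> t / \<tau> (t - 1))"
    by simp
  also have "\<dots> \<le> (1 - \<alpha>) / 2 * 1"
    using p \<alpha> \<eta>_step(1)[OF \<open>3 \<le> t\<close>] by (intro mult_left_mono) auto
  finally show "\<tau> t \<le> \<tau> (t - 1) + 1 / 2" using \<tau>_step[OF \<open>3 \<le> t\<close>] by (simp add: field_simps)
qed

lemma \<tau>_bounds:
  assumes "2 \<le> t"
  shows "1 \<le> \<tau> t" "\<alpha> / 2 * real t \<le> \<tau> t"
proof -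
  have "1 \<le> \<tau> t \<and> \<alpha> / 2 * real t \<le> \<tau> t"
    using assms
  proof (induction t rule: dec_induct)
    case base
    show ?case using \<tau>12 \<alpha> by simp
  next
    case (step t)
    then show ?case using \<tau>_growth(1)[of "Suc t"] \<alpha> by (simp add: field_simps)
  qed
  then show "1 \<le> \<tau> t" "\<alpha> / 2 * real t \<le> \<tau> t" by auto
qed

context
  fixes A c \<kappa> :: real
  assumes A: "0 < A" and c: "0 < c" and \<kappa>: "0 \<le> \<kappa>" "\<kappa> \<le> 1"
    and init: "inverse (\<eta> 1) \<le> c * A"
    and l_first: "l 1 \<le> 2 * A"
    and l_later: "\<And>t. 2 \<le> t \<Longrightarrow> l t \<le> 4 * (A * \<tau> t powr \<kappa>)"
begin

text \<open>The first entry stems from \<eta> 2 = (1 - \<beta>) \<eta> 1 and the assumed bound on 1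
  / \<eta> 1. The second is the worst curvature cap: 16 is the 4 of the rule times the 4 in the
  bound on l.\<close>

definition base_step :: real
  where "base_step = min ((1 - \<beta>) / c) (1 / 16)"

lemma base_step: "0 < base_step" "base_step \<le> (1 - \<beta>) / c" "base_step \<le> 1 / 16"
  unfolding base_step_def by (use \<beta> c in simp, rule min.cobounded1, rule min.cobounded2)

lemma capped_step:
  assumes "3 \<le> t" "4 * l (t - 1) * \<eta> t = \<tau> (t - 1)"
  shows "\<tau> (t - 1) powr (1 - \<kappa>) / (16 * A) \<le> \<eta> t"
proof -
  have \<tau>: "1 \<le> \<tau> (t - 1)" using \<tau>_bounds(1)[of "t - 1"] assms by simp
  have "\<tau> (t - 1) powr (1 - \<kappa>) * \<tau> (t - 1) powr \<kappa> = \<tau> (t - 1)"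
    using \<tau> by (simp flip: powr_add)
  also have "\<dots> = 4 * \<eta> t * l (t - 1)" using assms(2) by (simp add: mult_ac)
  also have "\<dots> \<le> 4 * \<eta> t * (4 * (A * \<tau> (t - 1) powr \<kappa>))"
    using l_later[of "t - 1"] assms \<eta>_pos[of t] by (intro mult_left_mono) auto
  finally have "\<tau> (t - 1) powr (1 - \<kappa>) * \<tau> (t - 1) powr \<kappa> \<le> (16 * A * \<eta> t) * \<tau> (t - 1) powr \<kappa>"
    by (simp add: mult_ac)
  then have "\<tau> (t - 1) powr (1 - \<kappa>) \<le> 16 * A * \<eta> t" using \<tau> by simp
  then show ?thesis using A by (simp add: field_simps)
qed

text \<open>Two increments of at most 1/2 give \<tau> t <= \<tau> (t - 2) + 1, so this cap lets
  \<eta> keep pace with \<tau>. At t = 3 the ratio is exactly 1 while \<tau> already grows, whence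
  the restriction to 4 <= t.\<close>

lemma \<tau>_ratio:
  assumes "3 \<le> t"
  shows "1 \<le> (\<tau> (t - 2) + 1) / \<tau> (t - 1)"
    "4 \<le> t \<Longrightarrow> \<tau> t / \<tau> (t - 1) \<le> (\<tau> (t - 2) + 1) / \<tau> (t - 1)"
proof -
  have \<tau>: "1 \<le> \<tau> (t - 1)" using \<tau>_bounds(1)[of "t - 1"] assms by simp
  show "1 \<le> (\<tau> (t - 2) + 1) / \<tau> (t - 1)"
  proof (cases "t = 3")
    case True
    then show ?thesis using \<tau>12 by simp
  next
    case False
    then have "3 \<le> t - 1" "2 \<le> t - 2" "t - 1 - 1 = t - 2" using assms by auto
    then show ?thesis using \<tau> \<tau>_growth(2)[of "t - 1"] \<tau>_bounds(1)[of "t - 2"] by simp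
  qed
  assume "4 \<le> t"
  then have "3 \<le> t - 1" "2 \<le> t - 2" "t - 1 - 1 = t - 2" by auto
  then show "\<tau> t / \<tau> (t - 1) \<le> (\<tau> (t - 2) + 1) / \<tau> (t - 1)"
    using \<tau> \<tau>_growth(2)[of "t - 1"] \<tau>_growth(2)[of t] \<tau>_bounds(1)[of "t - 2"] assms
    by (intro divide_right_mono) auto
qed

text \<open>The caps 4/3 and \<open>\<tau>_ratio\<close> never force \<eta> down; only the curvature
  cap can, and where it is attained \<open>capped_step\<close> bounds \<eta> below directly.\<close>

lemma \<eta>_ge_base:
  assumes "2 \<le> t"
  shows "base_step / A \<le> \<eta> t"
  using assms
proof (induction t rule: dec_induct)
  case base
  from \<eta>2(2) show ?case
  proof
    assume e: "\<eta> 2 = (1 - \<beta>) * \<eta> 1"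
    have "1 / (c * A) \<le> \<eta> 1" using init \<eta>_pos[of 1] A c by (simp add: field_simps)
    have "base_step / A \<le> (1 - \<beta>) / c / A" using base_step A by (intro divide_right_mono) auto
    also have "\<dots> = (1 - \<beta>) * (1 / (c * A))" by simp
    also have "\<dots> \<le> (1 - \<beta>) * \<eta> 1"
      using \<open>1 / (c * A) \<le> \<eta> 1\<close> \<beta> by (intro mult_left_mono) auto
    finally show ?thesis using e by simp
  next
    assume e: "4 * l 1 * \<eta> 2 = 1"
    have "\<eta> 2 * (4 * l 1) \<le> \<eta> 2 * (4 * (2 * A))" using l_first \<eta>_pos[of 2] by (intro mult_left_mono) auto
    then have "1 \<le> 8 * A * \<eta> 2" using e by (simp add: mult_ac)
    then have "1 / 16 / A \<le> \<eta> 2" using A by (simp add: field_simps)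
    moreover have "base_step / A \<le> 1 / 16 / A" using base_step A by (intro divide_right_mono) auto
    ultimately show ?thesis by simp
  qed
next
  case (step t)
  have p: "0 < \<eta> t" using \<eta>_pos step by simp
  from \<eta>_step(2)[of "Suc t"] step consider "\<eta> (Suc t) = 4 / 3 * \<eta> t"
    | "\<eta> (Suc t) = (\<tau> (Suc t - 2) + 1) / \<tau> (Suc t - 1) * \<eta> t" | "4 * l (Suc t - 1) * \<eta> (Suc t) = \<tau> (Suc t - 1)"
    by auto
  then show ?case
  proof cases
    case 1
    then show ?thesis using p step by simp
  next
    case 2
    have "1 * \<eta> t \<le> (\<tau> (Suc t - 2) + 1) / \<tau> (Suc t - 1) * \<eta> t"
      using \<tau>_ratio(1)[of "Suc t"] p step by (intro mult_right_mono) auto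
    then show ?thesis using 2 step by simp
  next
    case 3
    have "1 \<le> \<tau> t powr (1 - \<kappa>)" using \<tau>_bounds(1)[of t] \<kappa> step by (simp add: ge_one_powr_ge_zero)
    have "base_step / A \<le> 1 / 16 / A" using base_step A by (intro divide_right_mono) auto
    also have "\<dots> \<le> \<tau> t powr (1 - \<kappa>) / (16 * A)"
      using \<open>1 \<le> \<tau> t powr (1 - \<kappa>)\<close> A by (simp add: field_simps)
    also have "\<dots> \<le> \<eta> (Suc t)" using capped_step[of "Suc t"] 3 step by simp
    finally show ?thesis .
  qed
qed

lemma \<tau>_powr_mono: "a powr (1 - \<kappa>) \<le> d * b powr (1 - \<kappa>)" if "0 \<le> a" "0 \<le> b" "1 \<le> d" "a \<le> d * b" for a b d :: real
proof -
  have "a powr (1 - \<kappa>) \<le> (d * b) powr (1 - \<kappa>)" using that \<kappa> by (intro powr_mono2) auto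
  also have "\<dots> = d powr (1 - \<kappa>) * b powr (1 - \<kappa>)" using that by (simp add: powr_mult)
  also have "\<dots> \<le> d powr 1 * b powr (1 - \<kappa>)"
    using that \<kappa> by (intro mult_right_mono powr_mono) auto
  finally show ?thesis using that by simp
qed

text \<open>
  The cap \<open>4 / 3\<close> on the growth of \<open>\<eta>\<close> can be slower than that of \<open>\<tau>\<close> only while \<open>\<tau> \<le> 2\<close>, where
  the bound is already provided by \<open>base_step\<close>.
\<close>

lemma \<eta>_lower_bound:
  assumes "2 \<le> t"
  shows "base_step / 2 * \<tau> t powr (1 - \<kappa>) / A \<le> \<eta> t"
  using assms
proof (induction t rule: less_induct)
  case (less t)
  show ?case
  proof (cases "\<tau> t \<le> 2")
    case True
    \<comment> \<open>The half in \<open>base_step / 2\<close> pays for this factor 2.\<close>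
    have "\<tau> t powr (1 - \<kappa>) \<le> 2 * 1 powr (1 - \<kappa>)"
      using True \<tau>_bounds(1)[OF less.prems] by (intro \<tau>_powr_mono) auto
    then have "base_step / 2 * \<tau> t powr (1 - \<kappa>) / A \<le> base_step / 2 * (2 * 1 powr (1 - \<kappa>)) / A"
      using base_step A by (intro divide_right_mono mult_left_mono) auto
    then show ?thesis using \<eta>_ge_base[OF less.prems] by simp
  next
    case False
    then have "t \<noteq> 2" using \<tau>12 by auto
    then have "3 \<le> t" using less.prems by simp
    \<comment> \<open>\<tau> 3 is at most 1 + 1/2, below the threshold 2, so the exceptional index
      of \<open>\<tau>_ratio\<close> does not occur.\<close>
    have "t \<noteq> 3" using False \<tau>_growth(2)[of 3] \<tau>12 by auto
    then have "4 \<le> t" using \<open>3 \<le> t\<close> by simp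
    have prev: "1 \<le> \<tau> (t - 1)" "\<tau> t \<le> \<tau> (t - 1) + 1 / 2" "0 < \<eta> (t - 1)"
      using \<tau>_bounds(1)[of "t - 1"] \<tau>_growth(2)[of t] \<eta>_pos[of "t - 1"] \<open>3 \<le> t\<close> by auto
    have IH: "base_step / 2 * \<tau> (t - 1) powr (1 - \<kappa>) / A \<le> \<eta> (t - 1)"
      using less.IH[of "t - 1"] \<open>3 \<le> t\<close> by simp
    have grow: "\<tau> (t - 1) \<le> \<tau> t" using \<tau>_growth(1)[OF \<open>3 \<le> t\<close> prev(1)] \<alpha> by simp
    \<comment> \<open>\<tau> t > 2 gives \<tau> (t - 1) > 3/2, so an increment of at most 1/2 is a
      relative growth of at most 1/3. The threshold 2 is chosen for this.\<close>
    have ratio: "\<tau> t / \<tau> (t - 1) \<le> 4 / 3" using False prev by (simp add: field_simps)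
    have scaled: "base_step / 2 * \<tau> t powr (1 - \<kappa>) / A \<le> \<rho> * \<eta> (t - 1)" if "\<tau> t / \<tau> (t - 1) \<le> \<rho>" for \<rho>
    proof -
      have "base_step / 2 * \<tau> t powr (1 - \<kappa>) / A
          \<le> base_step / 2 * (\<tau> t / \<tau> (t - 1) * \<tau> (t - 1) powr (1 - \<kappa>)) / A"
        using base_step A prev grow
        by (intro divide_right_mono mult_left_mono \<tau>_powr_mono) auto
      also have "\<dots> = \<tau> t / \<tau> (t - 1) * (base_step / 2 * \<tau> (t - 1) powr (1 - \<kappa>) / A)" by (simp add: mult_ac)
      also have "\<dots> \<le> \<rho> * \<eta> (t - 1)"
        using IH that prev grow base_step A by (intro mult_mono) (auto intro: order_trans[rotated])
      finally show ?thesis .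
    qed
    from \<eta>_step(2)[OF \<open>3 \<le> t\<close>] consider "\<eta> t = 4 / 3 * \<eta> (t - 1)"
      | "\<eta> t = (\<tau> (t - 2) + 1) / \<tau> (t - 1) * \<eta> (t - 1)" | "4 * l (t - 1) * \<eta> t = \<tau> (t - 1)"
      by blast
    then show ?thesis
    proof cases
      case 1
      then show ?thesis using scaled[OF ratio] by simp
    next
      case 2
      then show ?thesis using scaled[OF \<tau>_ratio(2)[OF \<open>3 \<le> t\<close> \<open>4 \<le> t\<close>]] by simp
    next
      case 3
      have "base_step / 2 * \<tau> t powr (1 - \<kappa>) / A \<le> (1 / 16) / 2 * (2 * \<tau> (t - 1) powr (1 - \<kappa>)) / A"
        using base_step A prev False
        by (intro divide_right_mono mult_mono \<tau>_powr_mono) auto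
      also have "\<dots> \<le> \<eta> t" using capped_step[OF \<open>3 \<le> t\<close> 3] by simp
      finally show ?thesis .
    qed
  qed
qed

text \<open>Only the upper half of the indices is kept: at least k/2 terms, each at least
  (k/2)^(1-\<kappa>). Each of the two halvings costs at most a factor 2, uniformly in
  \<kappa>.\<close>

lemma sum_powr_lower:
  assumes "1 \<le> k"
  shows "real k powr (2 - \<kappa>) / 4 \<le> (\<Sum>t = 2..k + 1. real t powr (1 - \<kappa>))"
proof -
  let ?m = "k div 2"
  have "k \<le> 2 * (k - ?m)" "k \<le> 2 * (?m + 2)" by presburger+
  from this[THEN of_nat_mono[where 'a = real]]
  have k: "real k \<le> 2 * real (k - ?m)" "real k \<le> 2 * (real ?m + 2)" by simp_all
  have "real k powr (2 - \<kappa>) = real k * real k powr (1 - \<kappa>)"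
    using powr_add[of "real k" 1 "1 - \<kappa>"] assms by simp
  also have "\<dots> \<le> (2 * real (k - ?m)) * (2 * (real ?m + 2) powr (1 - \<kappa>))"
    using k by (intro mult_mono \<tau>_powr_mono) auto
  also have "\<dots> = 4 * (\<Sum>t = ?m + 2..k + 1. (real ?m + 2) powr (1 - \<kappa>))" by simp
  also have "(\<Sum>t = ?m + 2..k + 1. (real ?m + 2) powr (1 - \<kappa>)) \<le> (\<Sum>t = ?m + 2..k + 1. real t powr (1 - \<kappa>))"
    using \<kappa> by (intro sum_mono powr_mono2) auto
  also have "\<dots> \<le> (\<Sum>t = 2..k + 1. real t powr (1 - \<kappa>))" by (intro sum_mono2) auto
  finally show ?thesis by simp
qed

theorem sum_steps_lower_bound:
  assumes "1 \<le> k"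
  shows "min ((1 - \<beta>) / c) (1 / 16) * \<alpha> / 16 * real k powr (2 - \<kappa>) / A \<le> (\<Sum>t = 2..k + 1. \<eta> t)"
proof -
  have *: "base_step * \<alpha> / 4 * real t powr (1 - \<kappa>) / A \<le> \<eta> t" if "2 \<le> t" for t
  proof -
    \<comment> \<open>Here \<alpha> enters the constant, through \<tau> t >= \<alpha> t / 2.\<close>
    have "real t powr (1 - \<kappa>) \<le> 2 / \<alpha> * \<tau> t powr (1 - \<kappa>)"
      using \<tau>_bounds[OF that] \<alpha> by (intro \<tau>_powr_mono) (auto simp: field_simps)
    then have "base_step * \<alpha> / 4 * real t powr (1 - \<kappa>) / A
        \<le> base_step * \<alpha> / 4 * (2 / \<alpha> * \<tau> t powr (1 - \<kappa>)) / A"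
      using base_step A \<alpha> by (intro divide_right_mono mult_left_mono) auto
    also have "\<dots> = base_step / 2 * \<tau> t powr (1 - \<kappa>) / A" using \<alpha> by simp
    also have "\<dots> \<le> \<eta> t" using \<eta>_lower_bound[OF that] .
    finally show ?thesis .
  qed
  have "base_step * \<alpha> / 16 * real k powr (2 - \<kappa>) / A = base_step * \<alpha> / 4 * (real k powr (2 - \<kappa>) / 4) / A"
    by simp
  also have "\<dots> \<le> base_step * \<alpha> / 4 * (\<Sum>t = 2..k + 1. real t powr (1 - \<kappa>)) / A"
    using sum_powr_lower[OF assms] base_step A \<alpha> by (intro divide_right_mono mult_left_mono) auto
  also have "\<dots> = (\<Sum>t = 2..k + 1. base_step * \<alpha> / 4 * real t powr (1 - \<kappa>) / A)"
    by (simp only: sum_distrib_left sum_divide_distrib)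
  also have "\<dots> \<le> (\<Sum>t = 2..k + 1. \<eta> t)" by (intro sum_mono *) simp
  finally show ?thesis unfolding base_step_def .
qed

end

end

section \<open>From extended-real rules to real recursions\<close>

text \<open>For d = 0 the quotient is infinite and the cap inactive; the product form of the
  conclusion covers this case and d > 0 alike.\<close>

lemma ereal_capped_step:
  assumes "ereal e = min (ereal a) (ereal c / ereal d)" "0 < c" "0 \<le> d"
  shows "e \<le> a" "d * e \<le> c" "e = a \<or> d * e = c"
proof (atomize (full), cases "d = 0")
  case True
  then have "e = a" using assms by (simp add: min_def split: if_splits)
  then show "e \<le> a \<and> d * e \<le> c \<and> (e = a \<or> d * e = c)" using True assms by simp
next
  case False
  then have "e = min a (c / d)" using assms by (simp add: min_def split: if_splits)
  then show "e \<le> a \<and> d * e \<le> c \<and> (e = a \<or> d * e = c)"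
    using False assms by (auto simp: min_def field_simps split: if_splits)
qed

lemma capped_step_pos:
  fixes e a c d :: real
  assumes "e = a \<or> d * e = c" "0 < a" "0 < c" "0 \<le> d"
  shows "0 < e"
  using assms by (auto simp: zero_less_mult_iff)

lemma local_const_first:
  assumes "x 1 \<noteq> x 0" "0 < \<epsilon>"
  shows "\<exists>l\<ge>0. local_const f g \<tau> x \<epsilon> 1 = ereal l \<and>
    (norm (g (x 1) - g (x 0)))\<^sup>2 = l\<^sup>2 * (norm (x 1 - x 0))\<^sup>2 + l * \<epsilon> / 2"
proof -
  define D where "D = (norm (x 1 - x 0))\<^sup>2"
  define G where "G = (norm (g (x 1) - g (x 0)))\<^sup>2"
  define q where "q = sqrt (D * G + (\<epsilon> / 4)\<^sup>2)"
  define l where "l = (q - \<epsilon> / 4) / D"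
  have D: "0 < D" and G: "0 \<le> G" using assms by (auto simp: D_def G_def)
  have "\<epsilon> / 4 \<le> q" unfolding q_def using D G by (intro real_le_rsqrt) simp
  then have "0 \<le> l" using D by (simp add: l_def)
  have "q\<^sup>2 = D * G + (\<epsilon> / 4)\<^sup>2" unfolding q_def using D G by simp
  moreover have "q = l * D + \<epsilon> / 4" using D by (simp add: l_def)
  \<comment> \<open>Squaring q = l D + \<epsilon>/4 cancels (\<epsilon>/4)^2 and leaves the
    quadratic equation for l, multiplied by D.\<close>
  ultimately have "D * (l\<^sup>2 * D + l * \<epsilon> / 2) = D * G" by (simp add: power2_eq_square algebra_simps)
  then have "l\<^sup>2 * D + l * \<epsilon> / 2 = G" using D by simp
  moreover have "local_const f g \<tau> x \<epsilon> 1 = ereal l"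
    using D by (simp add: local_const_def l_def q_def D_def G_def)
  ultimately show ?thesis using \<open>0 \<le> l\<close> by (auto simp: D_def G_def)
qed

text \<open>The slack \<epsilon> / \<tau> t makes the denominator strictly positive even when the
  Bregman term vanishes, so the local constant is finite.\<close>

lemma local_const_later:
  assumes "2 \<le> t" "0 < \<epsilon>" "0 < \<tau> t"
    and "f (x t) + inner (g (x t)) (x (t - 1) - x t) \<le> f (x (t - 1))"
  shows "\<exists>l\<ge>0. local_const f g \<tau> x \<epsilon> t = ereal l \<and>
    (norm (g (x t) - g (x (t - 1))))\<^sup>2
      = l * (2 * (f (x (t - 1)) - f (x t) - inner (g (x t)) (x (t - 1) - x t)) + \<epsilon> / \<tau> t)"
proof -
  define D where "D = 2 * (f (x (t - 1)) - f (x t) - inner (g (x t)) (x (t - 1) - x t)) + \<epsilon> / \<tau> t"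
  have "0 < D" unfolding D_def using assms by (intro add_nonneg_pos) auto
  moreover from this have "local_const f g \<tau> x \<epsilon> t = ereal ((norm (g (x t) - g (x (t - 1))))\<^sup>2 / D)"
    using assms by (simp add: local_const_def D_def)
  ultimately show ?thesis unfolding D_def[symmetric]
    by (intro exI[of _ "(norm (g (x t) - g (x (t - 1))))\<^sup>2 / D"]) auto
qed

text \<open>With \<tau> t = t/2 the ratio cap becomes t / (t - 1), at most 4/3 for t >= 4; at t = 3
  it is 1 because \<tau> 1 = 0. So the extra cap 4/3 never binds, provided the step sizes are
  nonnegative, which is checked beforehand.\<close>

lemma linear_rule_imp_adaptive_rule:
  assumes "linear_rule \<beta> Lt \<eta> \<tau>" "\<beta> \<le> 1" "0 \<le> \<eta> 1" and Lt: "\<And>t. 1 \<le> t \<Longrightarrow> 0 \<le> Lt t"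
  shows "adaptive_rule 1 \<beta> Lt \<eta> \<tau>"
proof -
  have \<tau>: "\<tau> 1 = 0" "\<And>t. 2 \<le> t \<Longrightarrow> \<tau> t = real t / 2"
    and \<eta>2: "ereal (\<eta> 2) = min (ereal ((1 - \<beta>) * \<eta> 1)) (1 / (4 * Lt 1))"
    and \<eta>3: "ereal (\<eta> 3) = min (ereal (\<eta> 2)) (1 / (4 * Lt 2))"
    and \<eta>4: "\<And>t. 4 \<le> t \<Longrightarrow> ereal (\<eta> t)
      = min (ereal (real t / (real t - 1) * \<eta> (t - 1))) (ereal (real t - 1) / (8 * Lt (t - 1)))"
    using assms unfolding linear_rule_def by blast+
  have quot_nonneg: "0 \<le> ereal c / (ereal d * a)" if "0 \<le> a" "0 \<le> c" "0 < d" for a c d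
    using that by (cases a; cases "a = 0") auto
  have nonneg: "0 \<le> \<eta> t" if "2 \<le> t" for t
    using that
  proof (induction t rule: dec_induct)
    case base
    have "0 \<le> ereal (\<eta> 2)"
      unfolding \<eta>2 using assms(2,3) quot_nonneg[of "Lt 1" 1 4] Lt[of 1] by (simp add: one_ereal_def)
    then show ?case by simp
  next
    case (step t)
    have "0 \<le> ereal (\<eta> (Suc t))"
    proof (cases "t = 2")
      case True
      then have "Suc t = 3" by simp
      then show ?thesis
        using \<eta>3 step True Lt[of 2] quot_nonneg[of "Lt 2" 1 4] by (simp add: one_ereal_def)
    next
      case False
      then have "4 \<le> Suc t" using step by simp
      from \<eta>4[OF this] show ?thesis
        using step Lt[of t] quot_nonneg[of "Lt t" "real t" 8] by simp
    qed
    then show ?case by simp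
  qed
  have absorb: "min (ereal c) (min (ereal d) q) = min (ereal d) q" if "d \<le> c" for c d q
    using that by (metis ereal_less_eq(3) min.absorb2 min.assoc)
  have half: "ereal (real m / 2) / (4 * a) = ereal (real m) / (8 * a)" if "0 \<le> a" for a m
    using that by (cases a) (auto simp: field_simps)
  have "ereal (\<eta> t) = min (ereal (4 / 3 * \<eta> (t - 1)))
          (min (ereal ((\<tau> (t - 2) + 1) / \<tau> (t - 1) * \<eta> (t - 1)))
             (ereal (\<tau> (t - 1)) / (4 * Lt (t - 1))))" if "3 \<le> t" for t
  proof (cases "t = 3")
    case True
    have "t - 1 = 2" "t - 2 = 1" using True by auto
    moreover have "\<tau> 2 = 1" using \<tau>(2)[of 2] by simp
    moreover have "\<eta> 2 \<le> 4 / 3 * \<eta> 2" using nonneg[of 2] by simp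
    ultimately show ?thesis using \<eta>3 \<tau>(1) True absorb[of "\<eta> 2" "4 / 3 * \<eta> 2"]
      by (simp add: one_ereal_def)
  next
    case False
    then have t: "4 \<le> t" using that by simp
    have r: "(\<tau> (t - 2) + 1) / \<tau> (t - 1) = real t / (real t - 1)"
    proof -
      have e: "\<tau> (t - 1) = (real t - 1) / 2" "\<tau> (t - 2) = (real t - 2) / 2"
        using t \<tau>(2)[of "t - 1"] \<tau>(2)[of "t - 2"] by (simp_all add: of_nat_diff)
      show ?thesis unfolding e using t by (simp add: divide_simps)
    qed
    have "real t / (real t - 1) * \<eta> (t - 1) \<le> 4 / 3 * \<eta> (t - 1)"
      using t nonneg[of "t - 1"] by (intro mult_right_mono) (auto simp: field_simps)
    moreover have "ereal (\<tau> (t - 1)) / (4 * Lt (t - 1)) = ereal (real t - 1) / (8 * Lt (t - 1))"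
    proof -
      have e: "\<tau> (t - 1) = real (t - 1) / 2" "real (t - 1) = real t - 1" using t \<tau>(2)[of "t - 1"] by auto
      show ?thesis unfolding e(1) using half[of "Lt (t - 1)" "t - 1"] Lt[of "t - 1"] t e(2) by simp
    qed
    ultimately show ?thesis unfolding r using \<eta>4[OF t] absorb by metis
  qed
  moreover have "ereal (\<tau> t) = ereal (\<tau> (t - 1) + 1 / 2)
      + ereal (2 * (1 - 1) * \<eta> t) * Lt (t - 1) / ereal (\<tau> (t - 1))" if "3 \<le> t" for t
  proof -
    have "\<tau> t = \<tau> (t - 1) + 1 / 2" using that \<tau>(2)[of t] \<tau>(2)[of "t - 1"] by (simp add: of_nat_diff field_simps)
    \<comment> \<open>The local constant may be infinite at this point; 0 times it is still 0 in
      \<open>ereal\<close>.\<close>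
    moreover have "ereal (2 * (1 - 1) * \<eta> t) = 0" by simp
    ultimately show ?thesis by (simp only:) simp
  qed
  moreover have "\<tau> 2 = 1" using \<tau>(2)[of 2] by simp
  ultimately show ?thesis
    using \<tau>(1) \<eta>2 unfolding adaptive_rule_def by blast
qed

lemma convex_on_inner: "convex X \<Longrightarrow> convex_on X (inner a)"
  by (simp add: convex_on_def inner_add_right)

lemma complexity_factor:
  fixes L \<epsilon> \<nu> k :: real
  assumes "0 < L" "0 < \<epsilon>" "0 \<le> \<nu>" "0 < k"
  shows "(L\<^sup>2 / (\<epsilon> powr (1 - \<nu>) * k powr (1 + 3 * \<nu>))) powr (1 / (1 + \<nu>))
    = L powr (2 / (1 + \<nu>)) * (1 / \<epsilon>) powr ((1 - \<nu>) / (1 + \<nu>)) / k powr (2 - (1 - \<nu>) / (1 + \<nu>))"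
proof -
  have "(1 + 3 * \<nu>) / (1 + \<nu>) = 2 - (1 - \<nu>) / (1 + \<nu>)" using assms by (simp add: field_simps)
  moreover have "(L\<^sup>2) powr (1 / (1 + \<nu>)) = L powr (2 / (1 + \<nu>))"
    using assms powr_powr[of L 2 "1 / (1 + \<nu>)"] by simp
  ultimately show ?thesis using assms by (simp add: powr_divide powr_mult powr_powr)
qed

section \<open>Runs of the algorithm as instances of the abstract argument\<close>

context
  fixes \<beta> c\<^sub>0 :: real and n :: nat and X :: "fseq set" and f h :: "fseq \<Rightarrow> real" and g :: "fseq \<Rightarrow> fseq"
    and \<nu> L \<epsilon> :: real and \<eta> b \<tau> :: "nat \<Rightarrow> real" and z y x :: "nat \<Rightarrow> fseq"
  assumes run: "ac_fgm_run \<beta> c\<^sub>0 n X f h g \<nu> L \<epsilon> \<eta> b \<tau> z y x"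
    and \<beta>: "0 < \<beta>" "\<beta> \<le> 1 - sqrt 6 / 3"
begin

lemma beta_bounds: "\<beta> < 1" "5 / 8 \<le> 1 - \<beta>"
proof -
  show "\<beta> < 1" using \<beta> by (smt (verit) real_sqrt_gt_0_iff divide_pos_pos)
  have "15 / 8 \<le> sqrt 6" by (rule real_le_rsqrt) (simp add: power2_eq_square)
  then show "5 / 8 \<le> 1 - \<beta>" using \<beta> by simp
qed

lemma run_basics: "X \<subseteq> Rn n" "convex X" "convex_on X f" "convex_on X h"
  "0 \<le> \<nu>" "\<nu> \<le> 1" "0 < L" "0 < \<epsilon>" "0 < \<eta> 1" "x 1 \<noteq> x 0" "y 0 = x 0" "z 0 = x 0" "x 0 \<in> X"
proof -
  have "convex_on (Rn n) f" "X \<subseteq> Rn n" "convex X"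
    using run unfolding ac_fgm_run_def composite_problem_def convex_on_def by blast+
  then show "convex_on X f" by (rule convex_on_subset)
qed (use run in \<open>unfold ac_fgm_run_def composite_problem_def ac_fgm_def, blast+\<close>)

lemma run_params:
  shows "b 1 = 0" "2 \<le> t \<Longrightarrow> b t = \<beta>"
    and "inverse (\<eta> 1) \<le> c\<^sub>0 * (1 / \<epsilon>) powr ((1 - \<nu>) / (1 + \<nu>)) * L powr (2 / (1 + \<nu>))"
    and "ereal (\<eta> 1) \<le> 2 / (5 * local_const f g \<tau> x \<epsilon> 1)"
  using run unfolding ac_fgm_run_def by blast+

lemma run_oracle:
  assumes "u \<in> Rn n" "v \<in> Rn n"
  shows "g u \<in> Rn n" "f u + inner (g u) (v - u) \<le> f v" "norm (g u - g v) \<le> L * norm (u - v) powr \<nu>"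
proof -
  have "holder_oracle n f g \<nu> L" using run unfolding ac_fgm_run_def by blast
  then show "g u \<in> Rn n" "f u + inner (g u) (v - u) \<le> f v" "norm (g u - g v) \<le> L * norm (u - v) powr \<nu>"
    using assms unfolding holder_oracle_def subdifferential_def by blast+
qed

lemma run_step:
  assumes "1 \<le> t"
  shows "is_arg_min (\<lambda>u. \<eta> t * (inner (g (x (t - 1))) u + h u) + 1/2 * (norm (y (t - 1) - u))\<^sup>2)
        (\<lambda>u. u \<in> X) (z t)"
    "y t = (1 - b t) *\<^sub>R y (t - 1) + b t *\<^sub>R z t"
    "x t = (z t + \<tau> t *\<^sub>R x (t - 1)) /\<^sub>R (1 + \<tau> t)"
  using run assms unfolding ac_fgm_run_def ac_fgm_def by blast+

lemma z_mem: "z t \<in> X"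
proof (cases "t = 0")
  case True
  then show ?thesis using run_basics(12,13) by simp
next
  case False
  then show ?thesis using run_step(1)[of t] by (auto simp: is_arg_min_def)
qed

lemma x_mem_step:
  assumes "1 \<le> t" "0 \<le> \<tau> t" "x (t - 1) \<in> X"
  shows "x t \<in> X"
proof -
  have "x t = (1 / (1 + \<tau> t)) *\<^sub>R z t + (\<tau> t / (1 + \<tau> t)) *\<^sub>R x (t - 1)"
    using run_step(3)[OF \<open>1 \<le> t\<close>] by (simp add: scaleR_add_right divide_inverse mult.commute)
  moreover have "1 / (1 + \<tau> t) + \<tau> t / (1 + \<tau> t) = 1" using assms by (simp flip: add_divide_distrib)
  ultimately show ?thesis
    using run_basics(2) z_mem[of t] assms by (auto simp: convex_def)
qed

lemma subgrad: "u \<in> X \<Longrightarrow> v \<in> X \<Longrightarrow> f u + inner (g u) (v - u) \<le> f v"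
  using run_oracle(2) run_basics(1) by blast

text \<open>Under the linear rule \<tau> is explicit, so the x t lie in X by a plain induction, and
  the subgradient inequality then makes the local constants nonnegative.\<close>

lemma run_linear_imp_adaptive:
  assumes "linear_rule \<beta> (local_const f g \<tau> x \<epsilon>) \<eta> \<tau>"
  shows "adaptive_rule 1 \<beta> (local_const f g \<tau> x \<epsilon>) \<eta> \<tau>"
proof (rule linear_rule_imp_adaptive_rule[OF assms])
  have \<tau>: "\<tau> 1 = 0" "\<And>t. 2 \<le> t \<Longrightarrow> \<tau> t = real t / 2"
    using assms unfolding linear_rule_def by auto
  have "x t \<in> X" for t
  proof (induction t)
    case (Suc t)
    then show ?case using x_mem_step[of "Suc t"] \<tau> by (cases "t = 0") auto
  qed (rule run_basics(13))
  then show "0 \<le> local_const f g \<tau> x \<epsilon> t" if "1 \<le> t" for t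
    using local_const_first[of x \<epsilon> f g \<tau>] local_const_later[of t \<epsilon> \<tau> f x g] \<tau> subgrad run_basics that
    by (cases "t = 1") auto
qed (use beta_bounds run_basics in auto)

text \<open>
  Positivity of the step sizes, membership of the iterates in \<open>X\<close> and finiteness of the local constants
  depend on one another, so they are established in one induction.
\<close>

lemma adaptive_invariant:
  assumes rule: "adaptive_rule \<alpha> \<beta> (local_const f g \<tau> x \<epsilon>) \<eta> \<tau>" and \<alpha>: "0 < \<alpha>" "\<alpha> \<le> 1"
  shows "2 \<le> t \<Longrightarrow> 1 \<le> \<tau> t \<and> 0 \<le> \<tau> (t - 1) \<and> 0 < \<eta> t \<and> x t \<in> X \<and> x (t - 1) \<in> X"
proof (induction t rule: dec_induct)
  case base
  have \<tau>: "\<tau> 1 = 0" "\<tau> 2 = 1" using rule by (auto simp: adaptive_rule_def)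
  have x: "x 1 \<in> X" "x 2 \<in> X" using x_mem_step[of 1] x_mem_step[of 2] run_basics(13) \<tau> by auto
  obtain l where l: "0 \<le> l" "local_const f g \<tau> x \<epsilon> 1 = ereal l"
    using local_const_first[of x \<epsilon> f g \<tau>] run_basics by auto
  then have "ereal (\<eta> 2) = min (ereal ((1 - \<beta>) * \<eta> 1)) (ereal 1 / ereal (4 * l))"
    using rule by (simp add: adaptive_rule_def one_ereal_def)
  from ereal_capped_step(3)[OF this] l have "\<eta> 2 = (1 - \<beta>) * \<eta> 1 \<or> 4 * l * \<eta> 2 = 1" by simp
  then have "0 < \<eta> 2" by (rule capped_step_pos) (use l beta_bounds run_basics in auto)
  then show ?case using \<tau> x by simp
next
  case (step t)
  then have subg: "f (x t) + inner (g (x t)) (x (t - 1) - x t) \<le> f (x (t - 1))" using subgrad by blast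
  have "3 \<le> Suc t" using step by simp
  obtain l where l: "0 \<le> l" "local_const f g \<tau> x \<epsilon> t = ereal l"
    using local_const_later[of t \<epsilon> \<tau> f x g] run_basics subg step by auto
  have "ereal (\<eta> (Suc t)) = min (ereal (min (4 / 3 * \<eta> t) ((\<tau> (t - 1) + 1) / \<tau> t * \<eta> t))) (ereal (\<tau> t) / ereal (4 * l))"
    using rule \<open>3 \<le> Suc t\<close> l(2) unfolding adaptive_rule_def
    by (simp add: numeral_2_eq_2 ereal_min[symmetric] min.assoc del: ereal_min)
  from ereal_capped_step(3)[OF this] l step have "\<eta> (Suc t) = min (4 / 3 * \<eta> t) ((\<tau> (t - 1) + 1) / \<tau> t * \<eta> t) \<or> 4 * l * \<eta> (Suc t) = \<tau> t"
    by simp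
  then have \<eta>: "0 < \<eta> (Suc t)"
    by (rule capped_step_pos) (use l step in auto)
  have "ereal (\<tau> (Suc t)) = ereal (\<tau> (Suc t - 1) + \<alpha> / 2)
      + ereal (2 * (1 - \<alpha>) * \<eta> (Suc t)) * local_const f g \<tau> x \<epsilon> (Suc t - 1) / ereal (\<tau> (Suc t - 1))"
    using rule \<open>3 \<le> Suc t\<close> unfolding adaptive_rule_def by blast
  then have "ereal (\<tau> (Suc t)) = ereal (\<tau> t + \<alpha> / 2) + ereal (2 * (1 - \<alpha>) * \<eta> (Suc t)) * ereal l / ereal (\<tau> t)"
    using l(2) by (simp only: diff_Suc_1)
  then have "\<tau> (Suc t) = \<tau> t + \<alpha> / 2 + 2 * (1 - \<alpha>) * \<eta> (Suc t) * l / \<tau> t"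
    using step by simp
  moreover have "0 \<le> 2 * (1 - \<alpha>) * \<eta> (Suc t) * l / \<tau> t" using \<alpha> l \<eta> step by simp
  ultimately have "1 \<le> \<tau> (Suc t)" using step \<alpha> by simp
  then show ?case using \<eta> step x_mem_step[of "Suc t"] by simp
qed

theorem adaptive_convergence:
  assumes rule: "adaptive_rule \<alpha> \<beta> (local_const f g \<tau> x \<epsilon>) \<eta> \<tau>"
    and \<alpha>: "0 < \<alpha>" "\<alpha> \<le> 1" and "0 < c\<^sub>0" and "u \<in> X" and "1 \<le> k"
  shows "f (ergodic_mean \<eta> \<tau> x k) + h (ergodic_mean \<eta> \<tau> x k) - (f u + h u)
    \<le> 8 / (\<beta> * \<alpha> * min ((1 - \<beta>) / c\<^sub>0) (1 / 16))
        * (L\<^sup>2 / (\<epsilon> powr (1 - \<nu>) * real k powr (1 + 3 * \<nu>))) powr (1 / (1 + \<nu>))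
        * (norm (z 0 - u))\<^sup>2 + \<epsilon> / 2"
proof -
  define l where "l t = real_of_ereal (local_const f g \<tau> x \<epsilon> t)" for t
  have \<tau>12: "\<tau> 1 = 0" "\<tau> 2 = 1" using rule by (auto simp: adaptive_rule_def)
  note inv = adaptive_invariant[OF rule \<alpha>]
  have x: "x t \<in> X" for t
    using inv[of t] inv[of 2] run_basics(13) by (cases "t = 0"; cases "t = 1") auto
  have \<eta>_pos: "0 < \<eta> t" if "1 \<le> t" for t
    using inv[of t] run_basics(9) that by (cases "t = 1") auto
  have l1: "0 \<le> l 1" "local_const f g \<tau> x \<epsilon> 1 = ereal (l 1)"
    "(norm (g (x 1) - g (x 0)))\<^sup>2 = (l 1)\<^sup>2 * (norm (x 1 - x 0))\<^sup>2 + l 1 * \<epsilon> / 2"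
    using local_const_first[of x \<epsilon> f g \<tau>] run_basics unfolding l_def by auto
  have l2: "0 \<le> l t" "local_const f g \<tau> x \<epsilon> t = ereal (l t)"
    "(norm (g (x t) - g (x (t - 1))))\<^sup>2
      = l t * (2 * (f (x (t - 1)) - f (x t) - inner (g (x t)) (x (t - 1) - x t)) + \<epsilon> / \<tau> t)"
    if "2 \<le> t" for t
    using local_const_later[of t \<epsilon> \<tau> f x g] run_basics subgrad[OF x x] inv[OF that] that
    unfolding l_def by auto
  have l_nonneg: "0 \<le> l t" if "1 \<le> t" for t using l1(1) l2(1)[of t] that by (cases "t = 1") auto

  have "ereal (\<eta> 2) = min (ereal ((1 - \<beta>) * \<eta> 1)) (ereal 1 / ereal (4 * l 1))"
    using rule l1(2) by (simp add: adaptive_rule_def one_ereal_def)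
  from ereal_capped_step[OF this] l1(1)
  have \<eta>2: "\<eta> 2 \<le> (1 - \<beta>) * \<eta> 1" "4 * l 1 * \<eta> 2 \<le> 1" "\<eta> 2 = (1 - \<beta>) * \<eta> 1 \<or> 4 * l 1 * \<eta> 2 = 1"
    by auto
  have \<eta>3: "\<eta> t \<le> min (4 / 3 * \<eta> (t - 1)) ((\<tau> (t - 2) + 1) / \<tau> (t - 1) * \<eta> (t - 1))"
      "4 * l (t - 1) * \<eta> t \<le> \<tau> (t - 1)"
      "\<eta> t = min (4 / 3 * \<eta> (t - 1)) ((\<tau> (t - 2) + 1) / \<tau> (t - 1) * \<eta> (t - 1))
        \<or> 4 * l (t - 1) * \<eta> t = \<tau> (t - 1)"
    and \<tau>3: "\<tau> t = \<tau> (t - 1) + \<alpha> / 2 + 2 * (1 - \<alpha>) * \<eta> t * l (t - 1) / \<tau> (t - 1)"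
    if "3 \<le> t" for t
  proof -
    have t: "2 \<le> t - 1" using that by simp
    have "ereal (\<eta> t) = min (ereal (min (4 / 3 * \<eta> (t - 1)) ((\<tau> (t - 2) + 1) / \<tau> (t - 1) * \<eta> (t - 1))))
        (ereal (\<tau> (t - 1)) / ereal (4 * l (t - 1)))"
      using rule that l2(2)[OF t] unfolding adaptive_rule_def
      by (simp add: ereal_min[symmetric] min.assoc del: ereal_min)
    from ereal_capped_step[OF this] l2(1)[OF t] inv[OF t]
    show "\<eta> t \<le> min (4 / 3 * \<eta> (t - 1)) ((\<tau> (t - 2) + 1) / \<tau> (t - 1) * \<eta> (t - 1))"
      "4 * l (t - 1) * \<eta> t \<le> \<tau> (t - 1)"
      "\<eta> t = min (4 / 3 * \<eta> (t - 1)) ((\<tau> (t - 2) + 1) / \<tau> (t - 1) * \<eta> (t - 1))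
        \<or> 4 * l (t - 1) * \<eta> t = \<tau> (t - 1)"
      by auto
    have "ereal (\<tau> t) = ereal (\<tau> (t - 1) + \<alpha> / 2)
        + ereal (2 * (1 - \<alpha>) * \<eta> t) * ereal (l (t - 1)) / ereal (\<tau> (t - 1))"
      unfolding l2(2)[OF t, symmetric] using rule that unfolding adaptive_rule_def by blast
    then show "\<tau> t = \<tau> (t - 1) + \<alpha> / 2 + 2 * (1 - \<alpha>) * \<eta> t * l (t - 1) / \<tau> (t - 1)"
      using inv[OF t] by simp
  qed

  \<comment> \<open>The upper bound on \<eta> 1 acts here: if the curvature cap is attained, \<eta>
    2 = 1 / (4 l 1) is 5/8 of 2 / (5 l 1). Otherwise 1 - \<beta> >= 5/8 suffices.\<close>
  have first_ratio: "5 / 8 * \<eta> 1 \<le> \<eta> 2"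
    using \<eta>2(3)
  proof
    assume "\<eta> 2 = (1 - \<beta>) * \<eta> 1"
    then show ?thesis using beta_bounds \<eta>_pos[of 1] by simp
  next
    assume e: "4 * l 1 * \<eta> 2 = 1"
    then have "0 < l 1" using l1(1) by (cases "l 1 = 0") auto
    have "ereal (\<eta> 1) \<le> 2 / (5 * ereal (l 1))"
      using run_params(4) unfolding l1(2) .
    then have "5 * l 1 * \<eta> 1 \<le> 2" using \<open>0 < l 1\<close>
      by (simp add: field_simps)
    also have "2 = 8 * l 1 * \<eta> 2" using e by simp
    finally have "l 1 * (5 * \<eta> 1) \<le> l 1 * (8 * \<eta> 2)" by (simp add: mult_ac)
    then show ?thesis using \<open>0 < l 1\<close> by simp
  qed

  interpret D: composite_fgm X f h g \<beta> \<epsilon> \<eta> \<tau> l z y x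
  proof
    show "y 1 = x 0" using run_step(2)[of 1] run_params(1) run_basics(11) by simp
    show "\<eta> t * (inner (g (x (t - 1))) (z t - u) + h (z t) - h u) \<le> inner (y (t - 1) - z t) (z t - u)"
      if "1 \<le> t" "u \<in> X" for t u
    proof -
      have "convex_on X (\<lambda>u. \<eta> t * (inner (g (x (t - 1))) u + h u))"
        using \<eta>_pos[OF \<open>1 \<le> t\<close>] run_basics
        by (intro convex_on_cmul convex_on_add convex_on_inner) auto
      from prox_variational_inequality[OF this run_step(1)[OF \<open>1 \<le> t\<close>] \<open>u \<in> X\<close>]
      show ?thesis by (simp add: inner_diff_right algebra_simps)
    qed
    show "y t = (1 - \<beta>) *\<^sub>R y (t - 1) + \<beta> *\<^sub>R z t" if "2 \<le> t" for t
      using run_step(2)[of t] run_params(2)[OF that] that by simp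
    show "z t = x t + \<tau> t *\<^sub>R (x t - x (t - 1))" if "1 \<le> t" for t
    proof -
      have "0 \<le> \<tau> t" using inv[of t] \<tau>12 that by (cases "t = 1") auto
      then have "(1 + \<tau> t) *\<^sub>R x t = z t + \<tau> t *\<^sub>R x (t - 1)"
        using run_step(3)[OF that] by simp
      then show ?thesis by (simp add: algebra_simps)
    qed
    show "\<tau> (t + 1) * \<eta> (t + 2) \<le> (\<tau> t + 1) * \<eta> (t + 1)" if "1 \<le> t" for t
    proof -
      have "\<eta> (t + 2) \<le> (\<tau> t + 1) / \<tau> (t + 1) * \<eta> (t + 1)" using \<eta>3(1)[of "t + 2"] that by simp
      then show ?thesis using inv[of "t + 1"] that by (simp add: field_simps)
    qed
    show "\<eta> (t + 1) \<le> 4 / 3 * \<eta> t" "4 * l t * \<eta> (t + 1) \<le> \<tau> t" if "2 \<le> t" for t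
      using \<eta>3[of "t + 1"] that by simp_all
    show "0 < \<tau> t" if "2 \<le> t" for t using inv[OF that] by simp
  qed (fact run_basics(3,4,8,11,12) subgrad \<beta> \<eta>_pos \<tau>12 l_nonneg l1(3) l2(3) x z_mem \<eta>2(1,2) first_ratio)+

  have \<eta>_cases: "\<eta> t = 4 / 3 * \<eta> (t - 1) \<or> \<eta> t = (\<tau> (t - 2) + 1) / \<tau> (t - 1) * \<eta> (t - 1)
      \<or> 4 * l (t - 1) * \<eta> t = \<tau> (t - 1)" if "3 \<le> t" for t
    using \<eta>3(3)[OF that] by (metis min_def)
  interpret S: adaptive_steps \<alpha> \<beta> l \<eta> \<tau>
    by standard (fact \<alpha> \<beta>(1) beta_bounds(1) \<tau>12 \<eta>_pos l_nonneg \<eta>2(2,3) \<eta>3(2) \<eta>_cases \<tau>3)+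

  define \<kappa> where "\<kappa> = (1 - \<nu>) / (1 + \<nu>)"
  define A where "A = L powr (2 / (1 + \<nu>)) * (1 / \<epsilon>) powr \<kappa>"
  have A: "0 < A" using run_basics by (simp add: A_def)
  have \<kappa>: "0 \<le> \<kappa>" "\<kappa> \<le> 1" using run_basics by (auto simp: \<kappa>_def field_simps)
  have init: "inverse (\<eta> 1) \<le> c\<^sub>0 * A"
    using run_params(3) unfolding A_def \<kappa>_def by (simp only: mult_ac)
  have Rn: "x t \<in> Rn n" for t using x run_basics(1) by blast
  have first: "l 1 \<le> 2 * A"
    unfolding A_def \<kappa>_def
  proof (rule first_curvature_bound[where D = "norm (x 1 - x 0)"])
    show "(l 1)\<^sup>2 * (norm (x 1 - x 0))\<^sup>2 + l 1 * \<epsilon> / 2 \<le> (L * norm (x 1 - x 0) powr \<nu>)\<^sup>2"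
      unfolding l1(3)[symmetric] using run_oracle(3)[OF Rn Rn] by (intro power_mono) auto
  qed (use l1 run_basics in auto)
  have later: "l t \<le> 4 * (A * \<tau> t powr \<kappa>)" if "2 \<le> t" for t
  proof -
    let ?D = "2 * (f (x (t - 1)) - f (x t) - inner (g (x t)) (x (t - 1) - x t)) + \<epsilon> / \<tau> t"
    have \<tau>: "0 < \<tau> t" using inv[OF that] by simp
    have "0 < ?D"
      using subgrad[OF x x, of t "t - 1"] \<tau> run_basics by (intro add_nonneg_pos) auto
    \<comment> \<open>The smoothness gap is taken with \<delta> = \<epsilon> / \<tau> t, the slack
      in the local constant; this produces the factor \<tau> t powr \<kappa>.\<close>
    have "l t * ?D \<le> 4 * (L powr (2 / (1 + \<nu>)) * (1 / (\<epsilon> / \<tau> t)) powr ((1 - \<nu>) / (1 + \<nu>))) * ?D"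
      unfolding l2(3)[OF that, symmetric]
      using run_oracle \<tau> run_basics
      by (intro holder_smoothness_gap[OF subspace_Rn]) (auto intro: Rn)
    then have "l t \<le> 4 * (L powr (2 / (1 + \<nu>)) * (1 / (\<epsilon> / \<tau> t)) powr \<kappa>)"
      using \<open>0 < ?D\<close> unfolding \<kappa>_def by simp
    then show ?thesis using \<tau> run_basics by (simp add: A_def powr_divide)
  qed

  let ?m = "min ((1 - \<beta>) / c\<^sub>0) (1 / 16)"
  let ?N = "(norm (z 0 - u))\<^sup>2"
  have m: "0 < ?m" using beta_bounds \<open>0 < c\<^sub>0\<close> by simp
  let ?s = "?m * \<alpha> / 16 * real k powr (2 - \<kappa>) / A"
  have s: "0 < ?s" using m \<alpha> A \<open>1 \<le> k\<close> by simp
  have "?s \<le> (\<Sum>t = 2..k + 1. \<eta> t)"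
    by (rule S.sum_steps_lower_bound[OF A \<open>0 < c\<^sub>0\<close> \<kappa> init first later \<open>1 \<le> k\<close>])
  then have "?N / (2 * \<beta>) / (\<Sum>t = 2..k + 1. \<eta> t) \<le> ?N / (2 * \<beta>) / ?s"
    using s \<beta> by (intro divide_left_mono mult_pos_pos) auto
  also have "\<dots> = 8 / (\<beta> * \<alpha> * ?m) * (A / real k powr (2 - \<kappa>)) * ?N"
  proof -
    have "N / (2 * \<beta>) / (m * \<alpha> / 16 * p / A) = 8 / (\<beta> * \<alpha> * m) * (A / p) * N" for m N p :: real
      by (simp add: divide_simps)
    then show ?thesis .
  qed
  also have "A / real k powr (2 - \<kappa>) = (L\<^sup>2 / (\<epsilon> powr (1 - \<nu>) * real k powr (1 + 3 * \<nu>))) powr (1 / (1 + \<nu>))"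
    unfolding A_def \<kappa>_def using run_basics \<open>1 \<le> k\<close> by (subst complexity_factor) auto
  finally show ?thesis using D.ergodic_gap[OF \<open>u \<in> X\<close> \<open>1 \<le> k\<close>] by linarith
qed

end

theorem corollary3:
  fixes \<beta> c\<^sub>0 :: real
  assumes "0 < \<beta>" and "\<beta> \<le> 1 - sqrt 6 / 3" and "0 < c\<^sub>0"
  shows
    "(\<exists>C>0. \<forall>n X f h g \<nu> L \<epsilon> \<eta> b \<tau> z y x.
        ac_fgm_run \<beta> c\<^sub>0 n X f h g \<nu> L \<epsilon> \<eta> b \<tau> z y x \<longrightarrow>
        linear_rule \<beta> (local_const f g \<tau> x \<epsilon>) \<eta> \<tau> \<longrightarrow>
        (\<forall>xs \<in> minimizers X (\<lambda>u. f u + h u). \<forall>k\<ge>1.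
          (f (ergodic_mean \<eta> \<tau> x k) + h (ergodic_mean \<eta> \<tau> x k)) - (f xs + h xs)
          \<le> C * (L\<^sup>2 / (\<epsilon> powr (1 - \<nu>) * real k powr (1 + 3 * \<nu>))) powr (1 / (1 + \<nu>))
              * (norm (z 0 - xs))\<^sup>2 + \<epsilon> / 2)) \<and>
     (\<forall>\<alpha>. 0 < \<alpha> \<and> \<alpha> \<le> 1 \<longrightarrow>
       (\<exists>C>0. \<forall>n X f h g \<nu> L \<epsilon> \<eta> b \<tau> z y x.
        ac_fgm_run \<beta> c\<^sub>0 n X f h g \<nu> L \<epsilon> \<eta> b \<tau> z y x \<longrightarrow>
        adaptive_rule \<alpha> \<beta> (local_const f g \<tau> x \<epsilon>) \<eta> \<tau> \<longrightarrow>
        (\<forall>xs \<in> minimizers X (\<lambda>u. f u + h u). \<forall>k\<ge>1.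
          (f (ergodic_mean \<eta> \<tau> x k) + h (ergodic_mean \<eta> \<tau> x k)) - (f xs + h xs)
          \<le> C * (L\<^sup>2 / (\<epsilon> powr (1 - \<nu>) * real k powr (1 + 3 * \<nu>))) powr (1 / (1 + \<nu>))
              * (norm (z 0 - xs))\<^sup>2 + \<epsilon> / 2)))"
proof -
  have "\<beta> < 1" using assms by (smt (verit) real_sqrt_gt_0_iff divide_pos_pos)
  \<comment> \<open>The witness is explicit and fixed before any run is given. Its 8 is the 16 of
    \<open>sum_steps_lower_bound\<close> over the 2 in 1 / (2 \<beta>); the linear rule takes
    \<alpha> = 1.\<close>
  then have C: "0 < 8 / (\<beta> * \<alpha> * min ((1 - \<beta>) / c\<^sub>0) (1 / 16))" if "0 < \<alpha>" for \<alpha>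
    using assms that by simp
  have mem: "xs \<in> X" if "xs \<in> minimizers X F" for xs X and F :: "fseq \<Rightarrow> real"
    using that by (auto simp: minimizers_def is_arg_min_def)
  show ?thesis
  proof (intro conjI allI impI)
    show "\<exists>C>0. \<forall>n X f h g \<nu> L \<epsilon> \<eta> b \<tau> z y x.
        ac_fgm_run \<beta> c\<^sub>0 n X f h g \<nu> L \<epsilon> \<eta> b \<tau> z y x \<longrightarrow>
        linear_rule \<beta> (local_const f g \<tau> x \<epsilon>) \<eta> \<tau> \<longrightarrow>
        (\<forall>xs \<in> minimizers X (\<lambda>u. f u + h u). \<forall>k\<ge>1.
          (f (ergodic_mean \<eta> \<tau> x k) + h (ergodic_mean \<eta> \<tau> x k)) - (f xs + h xs)
          \<le> C * (L\<^sup>2 / (\<epsilon> powr (1 - \<nu>) * real k powr (1 + 3 * \<nu>))) powr (1 / (1 + \<nu>))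
              * (norm (z 0 - xs))\<^sup>2 + \<epsilon> / 2)"
      by (rule exI, rule conjI, rule C[of 1], simp, intro allI impI ballI,
          rule adaptive_convergence[OF _ assms(1,2) run_linear_imp_adaptive[OF _ assms(1,2)] _ _ assms(3)])
         (assumption | simp | erule mem)+
    show "\<exists>C>0. \<forall>n X f h g \<nu> L \<epsilon> \<eta> b \<tau> z y x.
        ac_fgm_run \<beta> c\<^sub>0 n X f h g \<nu> L \<epsilon> \<eta> b \<tau> z y x \<longrightarrow>
        adaptive_rule \<alpha> \<beta> (local_const f g \<tau> x \<epsilon>) \<eta> \<tau> \<longrightarrow>
        (\<forall>xs \<in> minimizers X (\<lambda>u. f u + h u). \<forall>k\<ge>1.
          (f (ergodic_mean \<eta> \<tau> x k) + h (ergodic_mean \<eta> \<tau> x k)) - (f xs + h xs)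
          \<le> C * (L\<^sup>2 / (\<epsilon> powr (1 - \<nu>) * real k powr (1 + 3 * \<nu>))) powr (1 / (1 + \<nu>))
              * (norm (z 0 - xs))\<^sup>2 + \<epsilon> / 2)" if "0 < \<alpha> \<and> \<alpha> \<le> 1" for \<alpha>
      by (rule exI, rule conjI, rule C[of \<alpha>], use that in simp, intro allI impI ballI,
          rule adaptive_convergence[OF _ assms(1,2) _ _ _ assms(3)])
         (assumption | simp add: that | erule mem)+
  qed
qed

end
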